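(* For every symmetric probability density $f\in\mathcal{F}_2\cap\mathcal{F}_{J_{\rm vdW}}$, $$\mathrm{ARE}^*_f(\phi^r_{\rm SWW}/\phi^r_{\rm vdW})=\mathrm{ARE}^*_f(\phi^r_{\rm K}/\phi^r_{\rm vdW})\le\left(\frac{6}{\pi}\right)^2.$$
   Context: $\mathcal{F}$ is the class of probability densities $f$ on $\mathbb{R}$ (with distribution function $F$ and quantile function $F^{-1}$) that admit a weak derivative $f'$ and are such that, with $\varphi_f:=-f'/f$, the Fisher information for location $\mathcal{I}(f)=\int_0^1\varphi_f^2(F^{-1}(u))\,du$ is finite. (One may take $f$ absolutely continuous with a.e. derivative $f'$.) $\mathcal{F}_2$ is the set of $f\in\mathcal{F}$ with finite second-order moment. Let $\mathcal{F}_0:=\{f\in\mathcal{F}:\lim_{x\to\pm\infty}f(x)=0\}$ and, for a differentiable score function $J$ on $(0,1)$, $\mathcal{F}_J:=\{f\in\mathcal{F}_0:\lim_{x\to\pm\infty}J(F(x))f(x)=0\}$. A density is symmetric if $f(-x)=f(x)$. For a square-integrable score function $J$ on $(0,1)$, let $\mathcal{K}(J):=\int_0^1J^2(u)\,du$, $\mathcal{K}(J,f):=\int_0^1J(u)\varphi_f(F^{-1}(u))\,du$ and $\mathcal{J}(J,f):=\int_0^1J(u)F^{-1}(u)\,du$. For score functions $J,\tilde J$, $\phi^r_{J\tilde J}$ denotes the test of serial dependence (against ARMA alternatives) based on the lag-$k$ rank autocorrelation, i.e. the standardized version of $(n-k)^{-1}\sum_{t=k+1}^nJ\big(\tfrac{R_t}{n+1}\big)\tilde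 J\big(\tfrac{R_{t-k}}{n+1}\big)$, where $R_1,\dots,R_n$ are the ranks of the observations. The asymptotic relative efficiency of $\phi^r_{J_1J_2}$ with respect to $\phi^r_{J_3J_4}$ under innovation density $f\in\mathcal{F}_2$ is $$\mathrm{ARE}^*_f(\phi^r_{J_1J_2}/\phi^r_{J_3J_4})=\frac{\mathcal{K}(J_3)}{\mathcal{K}(J_1)}\left(\frac{\mathcal{K}(J_1,f)}{\mathcal{K}(J_3,f)}\right)^2\frac{\mathcal{K}(J_4)}{\mathcal{K}(J_2)}\left(\frac{\mathcal{J}(J_2,f)}{\mathcal{J}(J_4,f)}\right)^2 .$$ $\phi^r_{\rm vdW}$ is the van der Waerden test, i.e. $\phi^r_{J_{\rm vdW}J_{\rm vdW}}$ with $J_{\rm vdW}(u)=\Phi^{-1}(u)$, $\Phi$ the standard normal distribution function. $\phi^r_{\rm SWW}$ is the Spearman-Wald-Wolfowitz test, i.e. $\phi^r_{J_{\rm W}J_{\rm W}}$ with $J_{\rm W}(u)=u-1/2$. $\phi^r_{\rm K}$ is the test based on Kendall rank autocorrelations (the standardized version of $1-4D_k/((n-k)(n-k-1))$, with $D_k$ the number of discordances at lag $k$). Kendall autocorrelations are asymptotically equivalent to the Spearman-Wald-Wolfowitz ones under the null hypothesis of independence, and accordingly the AREs of $\phi^r_{\rm K}$ are computed with the same scores $J_{\rm W},J_{\rm W}$ as for $\phi^r_{\rm SWW}$, i.e. $$\mathrm{ARE}^*_f(\phi^r_{\rm K}/\phi^r_{\rm vdW})=\left(\frac{\mathcal{K}(J_{\rm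 vdW})}{\mathcal{K}(J_{\rm W})}\right)^2\left(\frac{\mathcal{K}(J_{\rm W},f)}{\mathcal{K}(J_{\rm vdW},f)}\right)^2\left(\frac{\mathcal{J}(J_{\rm W},f)}{\mathcal{J}(J_{\rm vdW},f)}\right)^2 .$$ *)

theory Defs
  imports "HOL-Probability.Probability"
begin

(* Only the values for 0 < u < 1 are meaningful. *)
definition quantile :: "real measure \<Rightarrow> real \<Rightarrow> real" where
  "quantile M u = Inf {x. u \<le> cdf M x}"

definition prob_density :: "(real \<Rightarrow> real) \<Rightarrow> bool" where
  "prob_density f \<longleftrightarrow>
     f \<in> borel_measurable borel \<and> (\<forall>x. 0 \<le> f x) \<and> prob_space (density lborel f)"

abbreviation distr_fun :: "(real \<Rightarrow> real) \<Rightarrow> real \<Rightarrow> real" where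
  "distr_fun f \<equiv> cdf (density lborel f)"

abbreviation quantile_fun :: "(real \<Rightarrow> real) \<Rightarrow> real \<Rightarrow> real" where
  "quantile_fun f \<equiv> quantile (density lborel f)"

definition symmetric_density :: "(real \<Rightarrow> real) \<Rightarrow> bool" where
  "symmetric_density f \<longleftrightarrow> (\<forall>x. f (- x) = f x)"

definition locally_integrable :: "(real \<Rightarrow> real) \<Rightarrow> bool" where
  "locally_integrable f \<longleftrightarrow> (\<forall>a b. set_integrable lborel {a..b} f)"

(* Infinitely differentiable with compact support. *)
definition test_function :: "(real \<Rightarrow> real) \<Rightarrow> bool" where
  "test_function \<psi> \<longleftrightarrow>
     (\<forall>n x. (deriv ^^ n) \<psi> field_differentiable at x) \<and> compact (closure {x. \<psi> x \<noteq> 0})"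

definition has_weak_deriv :: "(real \<Rightarrow> real) \<Rightarrow> (real \<Rightarrow> real) \<Rightarrow> bool" where
  "has_weak_deriv f g \<longleftrightarrow>
     locally_integrable f \<and> locally_integrable g \<and>
     (\<forall>\<psi>. test_function \<psi> \<longrightarrow> (LBINT x. f x * deriv \<psi> x) = - (LBINT x. g x * \<psi> x))"

(* Weak derivatives are determined up to null sets, and every quantity below is
   insensitive to the version chosen. *)
definition weak_deriv :: "(real \<Rightarrow> real) \<Rightarrow> real \<Rightarrow> real" where
  "weak_deriv f = (SOME g. has_weak_deriv f g)"

(* The value at points where f vanishes is irrelevant: the quantile function
   maps Lebesgue measure on (0,1) to the distribution with density f. *)
definition location_score :: "(real \<Rightarrow> real) \<Rightarrow> real \<Rightarrow> real" where
  "location_score f x = - weak_deriv f x / f x"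

definition fisher_info :: "(real \<Rightarrow> real) \<Rightarrow> ennreal" where
  "fisher_info f =
     (\<integral>\<^sup>+u\<in>{0<..<1}. ennreal ((location_score f (quantile_fun f u))\<^sup>2) \<partial>lborel)"

definition class_F :: "(real \<Rightarrow> real) set" where
  "class_F = {f. prob_density f \<and> (\<exists>g. has_weak_deriv f g) \<and> fisher_info f < \<infinity>}"

definition class_F2 :: "(real \<Rightarrow> real) set" where
  "class_F2 = {f \<in> class_F. integrable lborel (\<lambda>x. x\<^sup>2 * f x)}"

definition class_F0 :: "(real \<Rightarrow> real) set" where
  "class_F0 = {f \<in> class_F. (f \<longlongrightarrow> 0) at_top \<and> (f \<longlongrightarrow> 0) at_bot}"

(* If f has support bounded on one side, J is evaluated at 0 or 1; as J 0 and J 1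
   are (arbitrary) reals and f tends to 0, the condition then holds on that side. *)
definition class_FJ :: "(real \<Rightarrow> real) \<Rightarrow> (real \<Rightarrow> real) set" where
  "class_FJ J = {f \<in> class_F0.
     ((\<lambda>x. J (distr_fun f x) * f x) \<longlongrightarrow> 0) at_top \<and>
     ((\<lambda>x. J (distr_fun f x) * f x) \<longlongrightarrow> 0) at_bot}"

definition score_norm :: "(real \<Rightarrow> real) \<Rightarrow> real" where
  "score_norm J = (LBINT u:{0<..<1}. (J u)\<^sup>2)"

definition score_K :: "(real \<Rightarrow> real) \<Rightarrow> (real \<Rightarrow> real) \<Rightarrow> real" where
  "score_K J f = (LBINT u:{0<..<1}. J u * location_score f (quantile_fun f u))"

definition score_J :: "(real \<Rightarrow> real) \<Rightarrow> (real \<Rightarrow> real) \<Rightarrow> real" where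
  "score_J J f = (LBINT u:{0<..<1}. J u * quantile_fun f u)"

(* ARE, under innovation density f, of the serial rank test with scores J1, J2
   with respect to the one with scores J3, J4. *)
definition ARE_serial ::
  "(real \<Rightarrow> real) \<Rightarrow> (real \<Rightarrow> real) \<Rightarrow> (real \<Rightarrow> real) \<Rightarrow> (real \<Rightarrow> real) \<Rightarrow> (real \<Rightarrow> real) \<Rightarrow> real"
  where
  "ARE_serial J1 J2 J3 J4 f =
     score_norm J3 / score_norm J1 * (score_K J1 f / score_K J3 f)\<^sup>2 *
     (score_norm J4 / score_norm J2) * (score_J J2 f / score_J J4 f)\<^sup>2"

definition J_vdW :: "real \<Rightarrow> real" where
  "J_vdW u = quantile std_normal_distribution u"

definition J_W :: "real \<Rightarrow> real" where
  "J_W u = u - 1 / 2"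

definition ARE_SWW_vdW :: "(real \<Rightarrow> real) \<Rightarrow> real" where
  "ARE_SWW_vdW f = ARE_serial J_W J_W J_vdW J_vdW f"

(* Kendall autocorrelations are not of the form covered by ARE_serial; they are
   asymptotically equivalent, under independence, to the ones with scores J_W, J_W. *)
definition ARE_Kendall_vdW :: "(real \<Rightarrow> real) \<Rightarrow> real" where
  "ARE_Kendall_vdW f =
     (score_norm J_vdW / score_norm J_W)\<^sup>2 *
     (score_K J_W f / score_K J_vdW f)\<^sup>2 * (score_J J_W f / score_J J_vdW f)\<^sup>2"

end

theory Submission
  imports Defs
begin

text \<open>Let Q denote the standard normal quantile function. The difference
  Q(u) / sqrt (2 pi) - (u - 1/2) is nondecreasing on (0,1), because the normal density is at most
  1 / sqrt (2 pi), and it has the sign of u - 1/2. The quantile function of a symmetric density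
  has the same sign, hence J(W,f) lies between 0 and J(vdW,f) / sqrt (2 pi). The score composed
  with the quantile function has integral 0 over (0,1), and its integral over (s,1) is the value
  of the continuous version of f at the s-quantile, which is nonnegative; so its integral against
  any nondecreasing weight is nonnegative, and K(W,f) lies between 0 and K(vdW,f) / sqrt (2 pi).
  Since the norms of the two scores are 1 and 1/12, the efficiency is at most
  (12 / (2 pi))^2 = (6 / pi)^2. If one of the integrals with van der Waerden scores vanishes, in
  particular if the integrand is not integrable, division by 0 makes the efficiency 0.\<close>

subsection \<open>Smooth step functions\<close>

text \<open>The tail integrals of the score are the delicate point, because \<open>f\<close> is only
  a Borel version of its density and is differentiable only in the weak sense. Testing must be
  converted into increments of a continuous version; since \<open>test_function\<close> demands
  derivatives of every order, admissible functions are built explicitly from exp (- 1/x). A second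
  obstacle is the zero set of the density. The distribution does not charge it, so the score is
  blind to it, whereas the increment formula integrates the weak derivative over it as well. The two
  agree because the derivative of an absolutely continuous function has integral 0 over the zero set
  within any interval, which is drawn from a chain rule for indefinite integrals. The score has no
  pointwise sign, so K can be compared only through integrals against monotone weights, while J
  allows a comparison of integrands. The total integral 0 of the score makes additive constants in a
  weight irrelevant.\<close>

text \<open>The derivatives of exp (- 1/x) are exp (- 1/x) times polynomials in 1/x.\<close>

definition flat :: "real poly \<Rightarrow> real \<Rightarrow> real" where
  "flat p x = (if 0 < x then poly p (1 / x) * exp (- (1 / x)) else 0)"

lemma tendsto_poly_exp_neg: "((\<lambda>y::real. poly p y * exp (- y)) \<longlongrightarrow> 0) at_top"
proof -
  have "((\<lambda>y. \<Sum>i\<le>degree p. coeff p i * (y ^ i / exp y)) \<longlongrightarrow> (\<Sum>i\<le>degree p. coeff p i * 0)) at_top"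
    by (intro tendsto_intros tendsto_power_div_exp_0)
  then show ?thesis
    by (simp add: poly_altdef exp_minus sum_divide_distrib flip: divide_inverse)
qed

lemma tendsto_flat_0: "(flat p \<longlongrightarrow> 0) (at 0)"
proof -
  have "((\<lambda>x. poly p (inverse x) * exp (- inverse x)) \<longlongrightarrow> 0) (at_right (0::real))"
    by (rule filterlim_compose[OF tendsto_poly_exp_neg filterlim_inverse_at_top_right])
  then have r: "(flat p \<longlongrightarrow> 0) (at_right 0)"
    by (rule Lim_transform_eventually)
       (auto simp: flat_def eventually_at_filter inverse_eq_divide)
  have l: "(flat p \<longlongrightarrow> 0) (at_left 0)"
    by (rule Lim_transform_eventually[OF tendsto_const])
       (auto simp: flat_def eventually_at_filter)
  from l r show ?thesis
    by (rule filterlim_split_at)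
qed

text \<open>With y = 1/x the inner derivative is -y^2, so p(y) exp (-y) turns into y^2 (p - p')(y)
  exp (-y), again a polynomial in y times exp (-y).\<close>

lemma has_real_derivative_flat:
  "(flat p has_real_derivative flat ([:0, 0, 1:] * (p - pderiv p)) x) (at x)"
proof -
  consider "x < 0" | "x = 0" | "0 < x" by linarith
  then show ?thesis
  proof cases
    case 1
    have "((\<lambda>_. 0) has_real_derivative 0) (at x)" by simp
    then have "(flat p has_real_derivative 0) (at x)"
      by (rule has_field_derivative_transform_within_open[where S="{..<0}"])
         (use 1 in \<open>auto simp: flat_def\<close>)
    with 1 show ?thesis by (simp add: flat_def)
  next
    case 2
    \<comment> \<open>Dividing by y multiplies the polynomial by its variable 1/y, so the difference
      quotient at 0 is itself of the form \<open>flat\<close> and tends to 0.\<close>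
    have "(\<lambda>y. (flat p y - flat p 0) / (y - 0)) = flat (pCons 0 p)"
      by (auto simp: flat_def fun_eq_iff)
    then have "(flat p has_real_derivative 0) (at 0)"
      unfolding has_field_derivative_iff using tendsto_flat_0 by simp
    with 2 show ?thesis by (simp add: flat_def)
  next
    case 3
    have "((\<lambda>x. poly p (1 / x) * exp (- (1 / x))) has_real_derivative
        flat ([:0, 0, 1:] * (p - pderiv p)) x) (at x)"
      using 3 by (auto intro!: derivative_eq_intros poly_DERIV[THEN DERIV_chain2]
          simp: flat_def field_simps power2_eq_square)
    then show ?thesis
      by (rule has_field_derivative_transform_within_open[where S="{0<..}"])
         (use 3 in \<open>auto simp: flat_def\<close>)
  qed
qed

text \<open>Membership is a syntactic certificate of smoothness: the class is closed under
  \<open>deriv\<close>, so induction reaches every iterated derivative without a formula for it.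
  Affine arguments sit in the base case to allow rescaling and translation; reciprocals serve the
  quotient in \<open>smooth_step\<close>.\<close>

inductive_set smooth_fns :: "(real \<Rightarrow> real) set" where
  flat: "(\<lambda>x. flat p (c * x + d)) \<in> smooth_fns"
| const: "(\<lambda>_. c) \<in> smooth_fns"
| add: "u \<in> smooth_fns \<Longrightarrow> v \<in> smooth_fns \<Longrightarrow> (\<lambda>x. u x + v x) \<in> smooth_fns"
| mult: "u \<in> smooth_fns \<Longrightarrow> v \<in> smooth_fns \<Longrightarrow> (\<lambda>x. u x * v x) \<in> smooth_fns"
| inverse: "u \<in> smooth_fns \<Longrightarrow> (\<And>x. u x \<noteq> 0) \<Longrightarrow> (\<lambda>x. inverse (u x)) \<in> smooth_fns"

lemma smooth_fns_deriv:
  "u \<in> smooth_fns \<Longrightarrow> \<exists>u'\<in>smooth_fns. \<forall>x. (u has_real_derivative u' x) (at x)"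
proof (induction rule: smooth_fns.induct)
  case (flat p c d)
  have "((\<lambda>x. flat p (c * x + d)) has_real_derivative
      flat ([:0, 0, 1:] * (p - pderiv p)) (c * x + d) * c) (at x)" for x
    by (rule DERIV_chain2[OF has_real_derivative_flat]) (auto intro!: derivative_eq_intros)
  then show ?case
    by (intro bexI[where x="\<lambda>x. flat ([:0, 0, 1:] * (p - pderiv p)) (c * x + d) * c"])
       (auto intro: smooth_fns.intros simp del: mult_pCons_left)
next
  case (const c)
  then show ?case
    by (intro bexI[where x="\<lambda>_. 0"]) (auto intro: smooth_fns.intros)
next
  case (add u v)
  then obtain u' v' where "u' \<in> smooth_fns" "v' \<in> smooth_fns"
    "\<And>x. (u has_real_derivative u' x) (at x)" "\<And>x. (v has_real_derivative v' x) (at x)" by blast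
  then show ?case
    by (intro bexI[where x="\<lambda>x. u' x + v' x"]) (auto intro: smooth_fns.intros DERIV_add)
next
  case (mult u v)
  then obtain u' v' where "u' \<in> smooth_fns" "v' \<in> smooth_fns"
    "\<And>x. (u has_real_derivative u' x) (at x)" "\<And>x. (v has_real_derivative v' x) (at x)" by blast
  with mult.hyps show ?case
    by (intro bexI[where x="\<lambda>x. u' x * v x + v' x * u x"])
       (auto intro: smooth_fns.intros DERIV_mult)
next
  case (inverse u)
  then obtain u' where "u' \<in> smooth_fns"
    "\<And>x. (u has_real_derivative u' x) (at x)" by blast
  with inverse.hyps show ?case
    by (intro bexI[where x="\<lambda>x. (- 1) * (inverse (u x) * u' x * inverse (u x))"] ballI allI
          smooth_fns.intros DERIV_inverse'[THEN DERIV_cong]) auto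
qed

lemma deriv_smooth_fns:
  assumes "u \<in> smooth_fns"
  shows "deriv u \<in> smooth_fns" "(u has_real_derivative deriv u x) (at x)"
proof -
  obtain u' where u': "u' \<in> smooth_fns" "\<And>x. (u has_real_derivative u' x) (at x)"
    using smooth_fns_deriv[OF assms] by blast
  then have "deriv u = u'"
    by (auto simp: DERIV_imp_deriv)
  with u' show "deriv u \<in> smooth_fns" "(u has_real_derivative deriv u x) (at x)"
    by auto
qed

lemma continuous_on_smooth_fns: "u \<in> smooth_fns \<Longrightarrow> continuous_on S u"
  using deriv_smooth_fns(2) by (blast intro: DERIV_continuous_on has_field_derivative_at_within)

lemma funpow_deriv_smooth_fns: "u \<in> smooth_fns \<Longrightarrow> (deriv ^^ n) u \<in> smooth_fns"
  by (induction n) (auto intro: deriv_smooth_fns)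

lemma smooth_fns_affine: "u \<in> smooth_fns \<Longrightarrow> (\<lambda>x. u (c * x + d)) \<in> smooth_fns"
proof (induction rule: smooth_fns.induct)
  case (flat p c' d')
  show ?case
    using smooth_fns.flat[of p "c' * c" "c' * d + d'"] by (simp add: algebra_simps)
qed (auto intro: smooth_fns.intros)

lemma test_function_smooth_fns:
  assumes "u \<in> smooth_fns" "\<And>x. x \<notin> {a..b} \<Longrightarrow> u x = 0"
  shows "test_function u"
proof -
  have "closure {x. u x \<noteq> 0} \<subseteq> {a..b}"
    using assms(2) by (intro closure_minimal subsetI) (auto intro: ccontr)
  then have "compact (closure {x. u x \<noteq> 0})"
    by (meson bounded_closed_interval bounded_subset closed_closure compact_eq_bounded_closed)
  then show ?thesis
    unfolding test_function_def field_differentiable_def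
    using deriv_smooth_fns(2)[OF funpow_deriv_smooth_fns[OF assms(1)]] by blast
qed

text \<open>The usual transition function, equal to 0 up to 0 and to 1 from 1 on. The denominator
  never vanishes, because x and 1 - x are not both nonpositive.\<close>

definition smooth_step :: "real \<Rightarrow> real" where
  "smooth_step x = flat 1 x * inverse (flat 1 x + flat 1 (1 - x))"

lemma smooth_step_in_smooth_fns: "smooth_step \<in> smooth_fns"
proof -
  have "flat 1 x + flat 1 (1 - x) \<noteq> 0" for x
    by (auto simp: flat_def add_eq_0_iff)
       (metis exp_gt_zero less_numeral_extra(3) neg_less_0_iff_less not_exp_less_zero)+
  moreover have "flat 1 \<in> smooth_fns" "(\<lambda>x. flat 1 (1 - x)) \<in> smooth_fns"
    using smooth_fns.flat[of 1 1 0] smooth_fns.flat[of 1 "-1" 1] by (simp_all add: algebra_simps)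
  ultimately show ?thesis
    unfolding smooth_step_def[abs_def] by (intro smooth_fns.intros) auto
qed

lemma smooth_step_eq_0: "x \<le> 0 \<Longrightarrow> smooth_step x = 0"
  and smooth_step_eq_1: "1 \<le> x \<Longrightarrow> smooth_step x = 1"
  and smooth_step_nonneg: "0 \<le> smooth_step x"
  and smooth_step_le_1: "smooth_step x \<le> 1"
  by (auto simp: smooth_step_def flat_def field_simps add_nonneg_pos)

lemma smooth_step_deriv: "(smooth_step has_real_derivative deriv smooth_step x) (at x)"
  by (rule deriv_smooth_fns(2)[OF smooth_step_in_smooth_fns])

lemma continuous_on_deriv_smooth_step: "continuous_on S (deriv smooth_step)"
  by (intro continuous_on_smooth_fns deriv_smooth_fns smooth_step_in_smooth_fns)

lemma deriv_smooth_step_eq_0: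
  assumes "x \<notin> {0..1}"
  shows "deriv smooth_step x = 0"
proof (cases "x < 0")
  case True
  have "((\<lambda>_. 0) has_real_derivative 0) (at x)" by simp
  then have "(smooth_step has_real_derivative 0) (at x)"
    by (rule has_field_derivative_transform_within_open[where S="{..<0}"])
       (use True in \<open>auto simp: smooth_step_eq_0\<close>)
  then show ?thesis by (rule DERIV_imp_deriv)
next
  case False
  have "((\<lambda>_. 1) has_real_derivative 0) (at x)" by simp
  then have "(smooth_step has_real_derivative 0) (at x)"
    by (rule has_field_derivative_transform_within_open[where S="{1<..}"])
       (use False assms in \<open>auto simp: smooth_step_eq_1\<close>)
  then show ?thesis by (rule DERIV_imp_deriv)
qed

lemma deriv_smooth_step_bounded: "\<exists>B. \<forall>x. \<bar>deriv smooth_step x\<bar> \<le> B"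
proof -
  have "compact (deriv smooth_step ` {0..1})"
    by (intro compact_continuous_image continuous_on_deriv_smooth_step) auto
  then obtain B where "0 < B" "\<And>x. x \<in> {0..1} \<Longrightarrow> \<bar>deriv smooth_step x\<bar> \<le> B"
    using compact_imp_bounded bounded_pos by (metis imageI real_norm_def)
  then show ?thesis
    using deriv_smooth_step_eq_0 by (metis abs_zero less_eq_real_def)
qed

subsection \<open>Primitives of weak derivatives\<close>

lemma set_integral_Ioc_Icc:
  fixes g :: "real \<Rightarrow> real"
  shows "(LBINT x:{a<..b}. g x) = (LBINT x:{a..b}. g x)"
  by (rule set_integral_discrete_difference[where X="{a}"]) auto

lemma set_integrable_Ioc:
  fixes g :: "real \<Rightarrow> real"
  shows "locally_integrable g \<Longrightarrow> set_integrable lborel {a<..b} g"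
  unfolding locally_integrable_def by (rule set_integrable_subset[of _ "{a..b}"]) auto

lemma borel_measurable_locally_integrable:
  assumes g: "locally_integrable g"
  shows "g \<in> borel_measurable borel"
proof -
  have "(\<lambda>n. indicator {- real n..real n} x *\<^sub>R g x) \<longlonglongrightarrow> g x" for x
  proof (rule tendsto_eventually)
    obtain k where "\<bar>x\<bar> \<le> real k" using real_arch_simple by blast
    then have "indicator {- real n..real n} x *\<^sub>R g x = g x" if "k \<le> n" for n
      using that by (auto simp: indicator_def)
    then show "eventually (\<lambda>n. indicator {- real n..real n} x *\<^sub>R g x = g x) sequentially"
      by (auto simp: eventually_sequentially)
  qed
  moreover have "(\<lambda>x. indicator {- real n..real n} x *\<^sub>R g x) \<in> borel_measurable borel" for n
    using g unfolding locally_integrable_def set_integrable_def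
    by (metis borel_measurable_integrable measurable_lborel2)
  ultimately show ?thesis
    by (rule borel_measurable_LIMSEQ_real)
qed

lemma set_integral_Ioc_combine:
  fixes g :: "real \<Rightarrow> real"
  assumes "locally_integrable g" "a \<le> b" "b \<le> c"
  shows "(LBINT x:{a<..c}. g x) = (LBINT x:{a<..b}. g x) + (LBINT x:{b<..c}. g x)"
  using assms
  by (subst ivl_disj_un_two(6)[symmetric, of a b c])
     (auto intro!: set_integral_Un set_integrable_Ioc)

lemma emeasure_lborel_Ioc_finite: "emeasure lborel {a<..b::real} < top"
  by (cases "a \<le> b") auto

text \<open>The kernel is the derivative in x of
  \<open>smooth_step (real (Suc n) * (x - a))\<close>: it has mass 1 and lives between a and a +
  1/(n + 1). Because it sits to the right of a, the limits below produce half-open intervals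
  \<open>{a<..b}\<close>.\<close>

definition mollify :: "(real \<Rightarrow> real) \<Rightarrow> nat \<Rightarrow> real \<Rightarrow> real" where
  "mollify f n a = (LBINT x. f x * (real (Suc n) * deriv smooth_step (real (Suc n) * (x - a))))"

lemma measurable_smooth_step[measurable]: "smooth_step \<in> borel_measurable borel"
  and measurable_deriv_smooth_step[measurable]: "deriv smooth_step \<in> borel_measurable borel"
  by (auto intro!: borel_measurable_continuous_onI continuous_on_smooth_fns
      smooth_step_in_smooth_fns deriv_smooth_fns)

lemma smooth_step_scaled_LIMSEQ:
  "(\<lambda>n. smooth_step (real (Suc n) * (x - a))) \<longlonglongrightarrow> indicator {a<..} x"
proof (cases "a < x")
  case True
  obtain m :: nat where m: "1 / (x - a) < real m"
    using reals_Archimedean2 by blast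
  have "smooth_step (real (Suc n) * (x - a)) = 1" if "m \<le> n" for n
  proof (rule smooth_step_eq_1)
    have "1 = (1 / (x - a)) * (x - a)" using True by simp
    also have "\<dots> \<le> real (Suc n) * (x - a)"
      using True m that by (intro mult_right_mono) auto
    finally show "1 \<le> real (Suc n) * (x - a)" .
  qed
  then have "eventually (\<lambda>n. smooth_step (real (Suc n) * (x - a)) = 1) sequentially"
    by (auto simp: eventually_sequentially)
  with True show ?thesis
    by (simp add: tendsto_eventually)
next
  case False
  then show ?thesis
    by (simp add: smooth_step_eq_0 mult_nonneg_nonpos)
qed

lemma abs_smooth_step_diff_le: "\<bar>smooth_step x - smooth_step y\<bar> \<le> 1"
  using smooth_step_nonneg[of x] smooth_step_nonneg[of y] smooth_step_le_1[of x]
    smooth_step_le_1[of y] by linarith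

lemma smooth_step_diff_LIMSEQ:
  assumes "a \<le> b"
  shows "(\<lambda>n. smooth_step (real (Suc n) * (x - a)) - smooth_step (real (Suc n) * (x - b)))
    \<longlonglongrightarrow> indicator {a<..b} x"
proof -
  have "indicator {a<..b} x = indicator {a<..} x - (indicator {b<..} x :: real)"
    using assms by (auto simp: indicator_def)
  then show ?thesis
    by (simp only: tendsto_diff[OF smooth_step_scaled_LIMSEQ smooth_step_scaled_LIMSEQ])
qed

text \<open>The scale is at least 1, so one unit beyond b both steps have reached 1, for every n. A
  support independent of n supplies the dominating function for the limits.\<close>

lemma smooth_step_diff_eq_0:
  assumes "a \<le> b" "x \<notin> {a..b + 1}"
  shows "smooth_step (real (Suc n) * (x - a)) - smooth_step (real (Suc n) * (x - b)) = 0"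
proof (cases "x < a")
  case True
  with assms show ?thesis
    by (simp add: smooth_step_eq_0 mult_nonneg_nonpos)
next
  case False
  with assms have "1 \<le> x - b" "1 \<le> x - a" by auto
  then have "1 * 1 \<le> real (Suc n) * (x - b)" "1 * 1 \<le> real (Suc n) * (x - a)"
    by (intro mult_mono; simp)+
  then show ?thesis by (simp add: smooth_step_eq_1)
qed

lemma integrable_mollify:
  fixes f :: "real \<Rightarrow> real"
  assumes "integrable lborel f"
  shows "integrable lborel (\<lambda>x. f x * (c * deriv smooth_step (c * (x - a))))"
proof -
  obtain B where B: "\<And>x. \<bar>deriv smooth_step x\<bar> \<le> B"
    using deriv_smooth_step_bounded by blast
  have [measurable]: "f \<in> borel_measurable lborel" using assms by auto
  show ?thesis
  proof (rule Bochner_Integration.integrable_bound)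
    show "integrable lborel (\<lambda>x. f x * (c * B))" using assms by auto
    show "AE x in lborel. norm (f x * (c * deriv smooth_step (c * (x - a)))) \<le> norm (f x * (c * B))"
      using B by (auto simp: abs_mult intro!: mult_left_mono AE_I2 order_trans[OF B])
  qed measurable
qed

text \<open>A single step is not compactly supported, but the difference of the steps at a and b is,
  and its derivative is the difference of the two kernels. This is why the weak derivative is tested
  for increments of the mollified function only.\<close>

lemma mollify_diff:
  assumes f: "integrable lborel f" and wd: "has_weak_deriv f g" and "a \<le> b"
  shows "mollify f n b - mollify f n a = (LBINT x. g x *
    (smooth_step (real (Suc n) * (x - a)) - smooth_step (real (Suc n) * (x - b))))"
proof -
  define c where "c = real (Suc n)"
  define \<psi> where "\<psi> = (\<lambda>x. smooth_step (c * (x - a)) - smooth_step (c * (x - b)))"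
  have aff: "(\<lambda>x. smooth_step (c * (x - y))) \<in> smooth_fns" for y
    using smooth_fns_affine[OF smooth_step_in_smooth_fns, of c "- c * y"]
    by (simp add: algebra_simps)
  have "(\<lambda>x. smooth_step (c * (x - a)) + (- 1) * smooth_step (c * (x - b))) \<in> smooth_fns"
    by (intro smooth_fns.intros aff)
  then have "\<psi> \<in> smooth_fns" by (simp add: \<psi>_def)
  then have "test_function \<psi>"
    by (rule test_function_smooth_fns[of _ a "b + 1"])
       (unfold \<psi>_def c_def, rule smooth_step_diff_eq_0[OF \<open>a \<le> b\<close>])
  then have eq: "(LBINT x. f x * deriv \<psi> x) = - (LBINT x. g x * \<psi> x)"
    using wd by (auto simp: has_weak_deriv_def)
  have "((\<lambda>x. smooth_step (c * (x - y))) has_real_derivative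
      deriv smooth_step (c * (x - y)) * c) (at x)" for x y
    by (rule DERIV_chain2[OF smooth_step_deriv]) (auto intro!: derivative_eq_intros)
  from DERIV_diff[OF this this]
  have "deriv \<psi> x = c * deriv smooth_step (c * (x - a)) - c * deriv smooth_step (c * (x - b))" for x
    unfolding \<psi>_def by (simp add: DERIV_imp_deriv mult.commute)
  then have "(LBINT x. f x * deriv \<psi> x) =
      (LBINT x. f x * (c * deriv smooth_step (c * (x - a))) - f x * (c * deriv smooth_step (c * (x - b))))"
    by (simp add: right_diff_distrib)
  also have "\<dots> = mollify f n a - mollify f n b"
    unfolding mollify_def c_def
    by (rule Bochner_Integration.integral_diff; rule integrable_mollify[OF f])
  finally show ?thesis using eq by (simp add: \<psi>_def c_def)
qed

lemma smooth_step_diff_integral: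
  fixes g :: "real \<Rightarrow> real"
  assumes g: "set_integrable lborel {a..b + 1} g" and [measurable]: "g \<in> borel_measurable lborel"
    and ab: "a \<le> b"
  defines "I \<equiv> \<lambda>n. LBINT x. g x *
    (smooth_step (real (Suc n) * (x - a)) - smooth_step (real (Suc n) * (x - b)))"
  shows smooth_step_diff_integral_LIMSEQ: "I \<longlonglongrightarrow> (LBINT x:{a<..b}. g x)"
    and smooth_step_diff_integral_bound: "\<bar>I n\<bar> \<le> (LBINT x:{a..b + 1}. \<bar>g x\<bar>)"
proof -
  have w: "integrable lborel (\<lambda>x. indicator {a..b + 1} x *\<^sub>R \<bar>g x\<bar>)"
    using set_integrable_abs[OF g] by (simp add: set_integrable_def)
  have bd: "norm (g x * (smooth_step (real (Suc n) * (x - a)) - smooth_step (real (Suc n) * (x - b))))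
      \<le> indicator {a..b + 1} x *\<^sub>R \<bar>g x\<bar>" for x n
  proof (cases "x \<in> {a..b + 1}")
    case True
    then show ?thesis
      using mult_left_mono[OF abs_smooth_step_diff_le, of "\<bar>g x\<bar>"] by (simp add: abs_mult)
  next
    case False
    then show ?thesis using smooth_step_diff_eq_0[OF ab] by simp
  qed
  show "I \<longlonglongrightarrow> (LBINT x:{a<..b}. g x)"
    unfolding I_def set_lebesgue_integral_def
  proof (rule integral_dominated_convergence[OF _ _ w])
    show "AE x in lborel. (\<lambda>n. g x * (smooth_step (real (Suc n) * (x - a)) -
        smooth_step (real (Suc n) * (x - b)))) \<longlonglongrightarrow> indicator {a<..b} x *\<^sub>R g x"
      using tendsto_mult[OF tendsto_const smooth_step_diff_LIMSEQ[OF ab]]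
      by (intro AE_I2) (simp add: mult.commute del: of_nat_Suc)
  qed (use bd in \<open>auto intro!: AE_I2\<close>)
  show "\<bar>I n\<bar> \<le> (LBINT x:{a..b + 1}. \<bar>g x\<bar>)"
    unfolding I_def set_lebesgue_integral_def real_norm_def[symmetric]
    by (rule order_trans[OF integral_norm_bound integral_mono])
       (use bd w in \<open>auto intro!: Bochner_Integration.integrable_bound[OF w] AE_I2\<close>)
qed

text \<open>Fubini moves the integration over y onto the kernel, where it is explicit. Limits can
  thus be taken in averages, without pointwise convergence of the mollified function.\<close>

lemma integral_mollify:
  assumes f: "integrable lborel f" and "c \<le> d"
  shows "(LBINT y:{c<..d}. mollify f n y) = (LBINT x. f x *
    (smooth_step (real (Suc n) * (x - c)) - smooth_step (real (Suc n) * (x - d))))"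
proof -
  define N where "N = real (Suc n)"
  define s where "s x y = N * deriv smooth_step (N * (x - y))" for x y
  obtain B where B: "\<And>x. \<bar>deriv smooth_step x\<bar> \<le> B"
    using deriv_smooth_step_bounded by blast
  have [measurable]: "f \<in> borel_measurable borel" using f by auto
  have [measurable]: "(\<lambda>(x, y). s x y) \<in> borel_measurable (borel \<Otimes>\<^sub>M borel)"
    unfolding s_def by measurable
  \<comment> \<open>For fixed n the kernel is bounded by \<open>N * B\<close>, so a multiple of this
    product dominates the integrand.\<close>
  have "integrable (lborel \<Otimes>\<^sub>M lborel) (\<lambda>(x, y). f x * indicator {c<..d} y)"
    using f integrable_real_indicator[of "{c<..d}" lborel]
    by (intro lborel_pair.Fubini_integrable)
       (auto simp: split_beta abs_mult emeasure_lborel_Ioc_finite intro!: AE_I2)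
  then have "integrable (lborel \<Otimes>\<^sub>M lborel) (\<lambda>z. (N * B) * (case z of (x, y) \<Rightarrow> f x * indicator {c<..d} y))"
    by (rule integrable_mult_right)
  then have int: "integrable (lborel \<Otimes>\<^sub>M lborel) (\<lambda>(x, y). indicator {c<..d} y *\<^sub>R (f x * s x y))"
  proof (rule Bochner_Integration.integrable_bound)
    have "norm (indicator {c<..d} y *\<^sub>R (f x * s x y)) \<le> norm (N * B * (f x * indicator {c<..d} y))" for x y
      using B[of "N * (x - y)"]
      by (auto simp: s_def abs_mult indicator_def mult.assoc mult.left_commute[of "\<bar>f x\<bar>"]
            mult.commute[of B] intro!: mult_left_mono)
    then show "AE z in lborel \<Otimes>\<^sub>M lborel. norm (case z of (x, y) \<Rightarrow> indicator {c<..d} y *\<^sub>R (f x * s x y))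
        \<le> norm (N * B * (case z of (x, y) \<Rightarrow> f x * indicator {c<..d} y))"
      by (auto intro!: AE_I2)
  qed measurable
  have "(LBINT y:{c<..d}. mollify f n y) = (LBINT y. LBINT x. indicator {c<..d} y *\<^sub>R (f x * s x y))"
    unfolding mollify_def set_lebesgue_integral_def s_def N_def by simp
  also have "\<dots> = (LBINT x. LBINT y. indicator {c<..d} y *\<^sub>R (f x * s x y))"
    by (rule lborel_pair.Fubini_integral[OF int])
  also have "\<dots> = (LBINT x. f x * (LBINT y:{c<..d}. s x y))"
    unfolding set_lebesgue_integral_def
    by (simp add: mult.left_commute flip: integral_mult_right_zero)
  also have "\<dots> = (LBINT x. f x * (smooth_step (N * (x - c)) - smooth_step (N * (x - d))))"
  proof -
    have "(LBINT y:{c<..d}. s x y) = - smooth_step (N * (x - d)) - - smooth_step (N * (x - c))" for x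
      unfolding set_integral_Ioc_Icc unfolding set_lebesgue_integral_def
    proof (rule integral_FTC_atLeastAtMost[OF \<open>c \<le> d\<close>])
      show "((\<lambda>y. - smooth_step (N * (x - y))) has_vector_derivative s x y) (at y within {c..d})" for y
      proof -
        have "((\<lambda>y. smooth_step (N * (x - y))) has_real_derivative
            deriv smooth_step (N * (x - y)) * (- N)) (at y within {c..d})"
          by (rule DERIV_chain2[OF smooth_step_deriv]) (auto intro!: derivative_eq_intros)
        from DERIV_minus[OF this] show ?thesis
          by (simp add: s_def has_real_derivative_iff_has_vector_derivative mult.commute)
      qed
      show "continuous_on {c..d} (s x)"
        unfolding s_def
        by (intro continuous_intros continuous_on_compose2[OF continuous_on_deriv_smooth_step[of UNIV]]) auto
    qed
    then show ?thesis by simp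
  qed
  finally show ?thesis by (simp only: N_def)
qed

text \<open>The lemma of du Bois-Reymond. Mollification turns the weak derivative identity into an
  increment formula for the mollified function; averaging over an interval makes the mollifier
  disappear from the left-hand side in the limit.\<close>

lemma weak_deriv_primitive:
  assumes f: "integrable lborel f" and wd: "has_weak_deriv f g"
  shows "\<exists>C. \<forall>d\<ge>r. (LBINT x:{r<..d}. f x) = (LBINT y:{r<..d}. C + (LBINT t:{r<..y}. g t))"
proof -
  define G where "G y = (LBINT t:{r<..y}. g t)" for y
  define m where "m n y = mollify f n y - mollify f n r" for n y
  have [measurable]: "f \<in> borel_measurable borel" using f by auto
  have g: "locally_integrable g" using wd by (simp add: has_weak_deriv_def)
  have gmeas: "g \<in> borel_measurable borel"
    using g by (rule borel_measurable_locally_integrable)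
  have [measurable]: "mollify f n \<in> borel_measurable borel" for n
    unfolding mollify_def by measurable
  have m_lim: "(\<lambda>n. m n y) \<longlonglongrightarrow> G y" and m_bd: "\<bar>m n y\<bar> \<le> (LBINT x:{r..y + 1}. \<bar>g x\<bar>)"
    if "r \<le> y" for n y
    unfolding m_def G_def mollify_diff[OF f wd that] using g gmeas that
    by (auto intro!: smooth_step_diff_integral_LIMSEQ smooth_step_diff_integral_bound
        simp: locally_integrable_def simp del: of_nat_Suc)
  have f_lim: "(\<lambda>n. LBINT y:{r<..d}. mollify f n y) \<longlonglongrightarrow> (LBINT x:{r<..d}. f x)" if "r \<le> d" for d
    unfolding integral_mollify[OF f that]
    using f that integrable_mult_indicator[OF _ f, of "{r..d + 1}"]
    by (intro smooth_step_diff_integral_LIMSEQ) (auto simp: set_integrable_def)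
  have dom: "norm (indicator {r<..d} y *\<^sub>R m n y)
      \<le> indicator {r<..d} y * (LBINT x:{r..d + 1}. \<bar>g x\<bar>)" for n y d
  proof (cases "y \<in> {r<..d}")
    case True
    have "(LBINT x:{r..y + 1}. \<bar>g x\<bar>) \<le> (LBINT x:{r..d + 1}. \<bar>g x\<bar>)"
      unfolding set_lebesgue_integral_def using True g
      by (intro integral_mono set_integrable_abs[unfolded set_integrable_def])
         (auto simp: locally_integrable_def set_integrable_def indicator_def)
    with True m_bd[of y n] show ?thesis by auto
  qed auto
  have m_int: "integrable lborel (\<lambda>y. indicator {r<..d} y *\<^sub>R m n y)"
    and m_int_lim: "(\<lambda>n. LBINT y:{r<..d}. m n y) \<longlonglongrightarrow> (LBINT y:{r<..d}. G y)"
    and G_int: "set_integrable lborel {r<..d} G" for n d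
  proof -
    have w: "integrable lborel (\<lambda>y. indicator {r<..d} y * (LBINT x:{r..d + 1}. \<bar>g x\<bar>))"
      by (intro integrable_mult_left integrable_real_indicator) (auto simp: emeasure_lborel_Ioc_finite)
    have lim: "(\<lambda>n. indicator {r<..d} y *\<^sub>R m n y) \<longlonglongrightarrow> indicator {r<..d} y *\<^sub>R G y" for y
      using m_lim[of y] by (cases "y \<in> {r<..d}") auto
    have meas: "(\<lambda>y. indicator {r<..d} y *\<^sub>R m n y) \<in> borel_measurable lborel" for n
      unfolding m_def by measurable
    have Gm: "(\<lambda>y. indicator {r<..d} y *\<^sub>R G y) \<in> borel_measurable lborel"
      using lim meas by (rule borel_measurable_LIMSEQ_real)
    show "integrable lborel (\<lambda>y. indicator {r<..d} y *\<^sub>R m n y)"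
      using dom by (intro Bochner_Integration.integrable_bound[OF w meas] AE_I2)
        (metis abs_ge_self order_trans real_norm_def)
    show "(\<lambda>n. LBINT y:{r<..d}. m n y) \<longlonglongrightarrow> (LBINT y:{r<..d}. G y)"
      unfolding set_lebesgue_integral_def
      by (rule integral_dominated_convergence[OF Gm meas w]) (intro AE_I2 lim dom)+
    show "set_integrable lborel {r<..d} G"
      unfolding set_integrable_def
      by (rule integrable_dominated_convergence[where s="\<lambda>n y. indicator {r<..d} y *\<^sub>R m n y", OF Gm meas w]) (intro AE_I2 lim dom)+
  qed
  have const: "set_integrable lborel {r<..d} (\<lambda>_. k)" "r \<le> d \<Longrightarrow> (LBINT y:{r<..d}. k) = (d - r) * k"
    for d k :: real
    by (auto simp: set_integrable_def set_lebesgue_integral_def emeasure_lborel_Ioc_finite)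
  have split: "(LBINT y:{r<..d}. mollify f n y) = (d - r) * mollify f n r + (LBINT y:{r<..d}. m n y)"
    if "r \<le> d" for n d
  proof -
    have "(LBINT y:{r<..d}. mollify f n y) = (LBINT y:{r<..d}. mollify f n r + m n y)"
      by (simp add: m_def)
    also have "\<dots> = (d - r) * mollify f n r + (LBINT y:{r<..d}. m n y)"
      using const that m_int by (subst set_integral_add) (auto simp: set_integrable_def)
    finally show ?thesis .
  qed
  \<comment> \<open>On an interval of length 1 the number \<open>mollify f n r\<close> is the
    integral of \<open>mollify f n\<close> minus that of \<open>m n\<close>. Both integrals
    converge, hence so do the values at the single point r.\<close>
  define C where "C = (LBINT x:{r<..r + 1}. f x) - (LBINT y:{r<..r + 1}. G y)"
  have "(\<lambda>n. (LBINT y:{r<..r + 1}. mollify f n y) - (LBINT y:{r<..r + 1}. m n y)) \<longlonglongrightarrow> C"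
    unfolding C_def by (intro tendsto_diff f_lim m_int_lim) auto
  then have r_lim: "(\<lambda>n. mollify f n r) \<longlonglongrightarrow> C"
    by (simp add: split)
  have "(LBINT x:{r<..d}. f x) = (LBINT y:{r<..d}. C + G y)" if "r \<le> d" for d
  proof -
    have "(\<lambda>n. LBINT y:{r<..d}. mollify f n y) \<longlonglongrightarrow> (d - r) * C + (LBINT y:{r<..d}. G y)"
      unfolding split[OF that] by (intro tendsto_intros r_lim m_int_lim)
    with f_lim[OF that] have "(LBINT x:{r<..d}. f x) = (d - r) * C + (LBINT y:{r<..d}. G y)"
      by (rule LIMSEQ_unique)
    also have "\<dots> = (LBINT y:{r<..d}. C + G y)"
      using const that G_int by (subst set_integral_add) auto
    finally show ?thesis .
  qed
  then show ?thesis unfolding G_def by blast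
qed

subsection \<open>The chain rule for absolutely continuous functions\<close>

text \<open>The mean value theorem yields a value between w a and w b, and the intermediate value
  theorem makes w attain it. So P' is evaluated on the path itself, at a parameter in
  \<open>{a..b}\<close>.\<close>

lemma MVT_along_path:
  fixes w P P' :: "real \<Rightarrow> real"
  assumes P: "\<And>y. (P has_real_derivative P' y) (at y)"
    and w: "continuous_on {a..b} w" and "a \<le> b"
  shows "\<exists>z\<in>{a..b}. P (w b) - P (w a) = P' (w z) * (w b - w a)"
proof -
  consider "w a < w b" | "w a = w b" | "w b < w a" by linarith
  then show ?thesis
  proof cases
    case 1
    obtain \<xi> where "w a < \<xi>" "\<xi> < w b" "P (w b) - P (w a) = (w b - w a) * P' \<xi>"
      using MVT2[OF 1, of P P'] P by auto
    with IVT'[of w a \<xi> b] w \<open>a \<le> b\<close> show ?thesis by (force simp: mult.commute)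
  next
    case 2
    with \<open>a \<le> b\<close> show ?thesis by (intro bexI[of _ a]) auto
  next
    case 3
    obtain \<xi> where "w b < \<xi>" "\<xi> < w a" and \<xi>: "P (w a) - P (w b) = (w a - w b) * P' \<xi>"
      using MVT2[OF 3, of P P'] P by auto
    then obtain z where "a \<le> z" "z \<le> b" "w z = \<xi>"
      using IVT2'[of w b \<xi> a] w \<open>a \<le> b\<close> by force
    with \<xi> show ?thesis
      by (intro bexI[of _ z]) (auto simp: algebra_simps)
  qed
qed

text \<open>Local absolute continuity of w with derivative g, in integrated form: the arguments
  below refer to increments of w, never to its derivative at a point.\<close>

locale integral_path =
  fixes g w :: "real \<Rightarrow> real"
  assumes loc_int: "locally_integrable g"
    and increment: "\<And>x y. x \<le> y \<Longrightarrow> w y - w x = (LBINT t:{x<..y}. g t)"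
    and cont: "continuous_on UNIV w"
begin

lemma measurable_w[measurable]: "w \<in> borel_measurable borel"
  using cont by (rule borel_measurable_continuous_onI)

lemma locally_integrable_mult:
  assumes "continuous_on UNIV h"
  shows "locally_integrable (\<lambda>t. h t * g t)"
  unfolding locally_integrable_def
proof (intro allI)
  fix a b :: real
  have "compact (h ` {a..b})"
    using assms by (intro compact_continuous_image) (auto intro: continuous_on_subset)
  then obtain K where K: "\<And>x. x \<in> {a..b} \<Longrightarrow> \<bar>h x\<bar> \<le> K"
    using compact_imp_bounded bounded_iff by (metis imageI real_norm_def)
  have [measurable]: "h \<in> borel_measurable borel"
    using assms by (rule borel_measurable_continuous_onI)
  have g: "set_integrable lborel {a..b} g" using loc_int by (auto simp: locally_integrable_def)
  then have [measurable]: "(\<lambda>x. indicator {a..b} x *\<^sub>R g x) \<in> borel_measurable borel"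
    unfolding set_integrable_def by (metis borel_measurable_integrable measurable_lborel2)
  have "integrable lborel (\<lambda>x. h x * (indicator {a..b} x *\<^sub>R g x))"
  proof (rule Bochner_Integration.integrable_bound)
    show "integrable lborel (\<lambda>x. K * (indicator {a..b} x *\<^sub>R g x))"
      using g unfolding set_integrable_def by (rule integrable_mult_right)
    show "AE x in lborel. norm (h x * (indicator {a..b} x *\<^sub>R g x))
        \<le> norm (K * (indicator {a..b} x *\<^sub>R g x))"
    proof (intro AE_I2)
      fix x
      show "norm (h x * (indicator {a..b} x *\<^sub>R g x)) \<le> norm (K * (indicator {a..b} x *\<^sub>R g x))"
        using K[of x] by (cases "x \<in> {a..b}") (auto simp: abs_mult intro!: mult_right_mono)
    qed
  qed measurable
  then show "set_integrable lborel {a..b} (\<lambda>t. h t * g t)"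
    unfolding set_integrable_def by (simp add: mult.left_commute)
qed

lemma set_integrable_Ioc_g: "set_integrable lborel {a<..b} g"
  by (rule set_integrable_Ioc[OF loc_int])

text \<open>The defect \<open>\<Delta>\<close> of the formula and the integral \<open>V\<close> of
  \<bar>g\<bar> are additive over adjacent intervals. On short intervals
  \<open>MVT_along_path\<close> and the continuity of P' along w bound the defect by e times
  \<open>V\<close>; bisection extends the bound to the whole interval, and e is arbitrary.\<close>

lemma chain_rule:
  assumes P: "\<And>y. (P has_real_derivative P' y) (at y)" and P': "continuous_on UNIV P'"
    and "a \<le> b"
  shows "P (w b) - P (w a) = (LBINT t:{a<..b}. P' (w t) * g t)"
proof -
  have cont_P'w: "continuous_on UNIV (\<lambda>t. P' (w t))"
    using continuous_on_compose2[OF P' cont] by simp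
  have loc_int': "locally_integrable (\<lambda>t. P' (w t) * g t)"
    by (rule locally_integrable_mult[OF cont_P'w])
  have loc_int_abs: "locally_integrable (\<lambda>t. \<bar>g t\<bar>)"
    using loc_int by (auto simp: locally_integrable_def intro: set_integrable_abs)
  define \<Delta> where "\<Delta> x y = P (w y) - P (w x) - (LBINT t:{x<..y}. P' (w t) * g t)" for x y
  define V where "V x y = (LBINT t:{x<..y}. \<bar>g t\<bar>)" for x y
  have \<Delta>_add: "\<Delta> x z = \<Delta> x y + \<Delta> y z" and V_add: "V x z = V x y + V y z"
    if "x \<le> y" "y \<le> z" for x y z
    using set_integral_Ioc_combine[OF loc_int' that] set_integral_Ioc_combine[OF loc_int_abs that]
    by (simp_all add: \<Delta>_def V_def)
  have V_nonneg: "0 \<le> V x y" for x y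
    unfolding V_def set_lebesgue_integral_def by (rule Bochner_Integration.integral_nonneg) auto
  have small: "\<bar>\<Delta> a b\<bar> \<le> e * V a b" if "0 < e" for e
  proof -
    have "a \<le> b \<longrightarrow> \<bar>\<Delta> a b\<bar> \<le> e * V a b"
      using \<open>a \<le> b\<close>
    proof (induction a b rule: Bolzano)
      case (trans x y z)
      then show ?case
        using \<Delta>_add[of x y z] V_add[of x y z] by (auto simp: distrib_left)
    next
      case (local x)
      obtain d where d: "0 < d" "\<And>t. \<bar>t - x\<bar> < d \<Longrightarrow> \<bar>P' (w t) - P' (w x)\<bar> < e / 2"
        using cont_P'w[unfolded continuous_on_iff, rule_format, of x "e / 2"] \<open>0 < e\<close>
        by (auto simp: dist_real_def)
      have "\<bar>\<Delta> l u\<bar> \<le> e * V l u" if lu: "l \<le> x" "x \<le> u" "u - l < d" for l u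
      proof -
        have "l \<le> u" using lu by auto
        then obtain z where z: "z \<in> {l..u}" "P (w u) - P (w l) = P' (w z) * (w u - w l)"
          using MVT_along_path[of P P' l u w, OF P] cont by (meson continuous_on_subset subset_UNIV)
        have "P (w u) - P (w l) = (LBINT t:{l<..u}. P' (w z) * g t)"
          using z increment[OF \<open>l \<le> u\<close>] by simp
        then have "\<Delta> l u = (LBINT t:{l<..u}. P' (w z) * g t - P' (w t) * g t)"
          unfolding \<Delta>_def using set_integrable_Ioc[OF loc_int'] set_integrable_Ioc_g
          by (subst set_integral_diff) auto
        also have "\<bar>\<dots>\<bar> \<le> (LBINT t:{l<..u}. \<bar>P' (w z) * g t - P' (w t) * g t\<bar>)"
          unfolding set_lebesgue_integral_def
          by (rule order_trans[OF integral_abs_bound]) (simp add: abs_mult)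
        also have "\<dots> \<le> (LBINT t:{l<..u}. e * \<bar>g t\<bar>)"
        proof (rule set_integral_mono)
          show "set_integrable lborel {l<..u} (\<lambda>t. \<bar>P' (w z) * g t - P' (w t) * g t\<bar>)"
            using set_integrable_Ioc[OF loc_int'] set_integrable_Ioc_g
            by (intro set_integrable_abs set_integral_diff) auto
          show "set_integrable lborel {l<..u} (\<lambda>t. e * \<bar>g t\<bar>)"
            using set_integrable_Ioc[OF loc_int_abs] by auto
          fix t assume t: "t \<in> {l<..u}"
          have "\<bar>z - x\<bar> < d" "\<bar>t - x\<bar> < d" using lu t z(1) by auto
          from this[THEN d(2)] have "\<bar>P' (w z) - P' (w t)\<bar> \<le> e" by linarith
          then have "\<bar>P' (w z) - P' (w t)\<bar> * \<bar>g t\<bar> \<le> e * \<bar>g t\<bar>"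
            by (rule mult_right_mono) auto
          then show "\<bar>P' (w z) * g t - P' (w t) * g t\<bar> \<le> e * \<bar>g t\<bar>"
            by (simp add: abs_mult flip: left_diff_distrib)
        qed
        finally show ?thesis by (simp add: V_def)
      qed
      with d(1) show ?case by blast
    qed
    with \<open>a \<le> b\<close> show ?thesis by simp
  qed
  have "\<Delta> a b = 0"
  proof (rule ccontr)
    assume "\<Delta> a b \<noteq> 0"
    then have "0 < \<bar>\<Delta> a b\<bar>" by simp
    \<comment> \<open>This choice of e forces a contradiction through V / (V + 1) < 1; the added 1
      keeps the denominator positive even if \<open>V a b\<close> is 0.\<close>
    moreover have "\<bar>\<Delta> a b\<bar> \<le> \<bar>\<Delta> a b\<bar> / (V a b + 1) * V a b"
      using \<open>\<Delta> a b \<noteq> 0\<close> V_nonneg[of a b] by (intro small divide_pos_pos) auto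
    ultimately show False
      using V_nonneg[of a b] by (simp add: field_simps)
  qed
  then show ?thesis by (simp add: \<Delta>_def)
qed

text \<open>The functions arctan (n y) / n tend uniformly to 0 while their derivatives tend to
  the indicator function of {0}.\<close>

lemma integral_nonzero_set:
  assumes "a \<le> b"
  shows "(LBINT t:{a<..b}. if w t = 0 then 0 else g t) = w b - w a"
proof -
  define P' where "P' n y = inverse (1 + (real (Suc n) * y)\<^sup>2)" for n y
  have "((\<lambda>y. arctan (real (Suc n) * y) / real (Suc n)) has_real_derivative P' n y) (at y)" for n y
  proof -
    have "((\<lambda>y. arctan (real (Suc n) * y) / real (Suc n)) has_real_derivative
        (inverse (1 + (real (Suc n) * y)\<^sup>2) * real (Suc n)) / real (Suc n)) (at y)"
      by (intro DERIV_cdivide DERIV_chain2[OF DERIV_arctan]) (auto intro!: derivative_eq_intros)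
    then show ?thesis by (simp add: P'_def)
  qed
  moreover have "continuous_on UNIV (P' n)" for n
  proof -
    have "1 + (real (Suc n) * y)\<^sup>2 \<noteq> 0" for y
      by (metis add_nonneg_eq_0_iff zero_le_one zero_le_power2 zero_neq_one)
    then show ?thesis unfolding P'_def by (intro continuous_intros) auto
  qed
  ultimately have eq: "arctan (real (Suc n) * w b) / real (Suc n) - arctan (real (Suc n) * w a) / real (Suc n)
      = (LBINT t:{a<..b}. P' n (w t) * g t)" and meas: "P' n \<in> borel_measurable borel" for n
    using chain_rule[of "\<lambda>y. arctan (real (Suc n) * y) / real (Suc n)" "P' n"] \<open>a \<le> b\<close>
    by (auto intro: borel_measurable_continuous_onI)
  have arctan_lim: "(\<lambda>n. arctan (real (Suc n) * c) / real (Suc n)) \<longlonglongrightarrow> 0" for c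
  proof (rule Lim_null_comparison)
    show "eventually (\<lambda>n. norm (arctan (real (Suc n) * c) / real (Suc n)) \<le> 2 * inverse (real (Suc n))) sequentially"
    proof (intro always_eventually allI)
      fix n
      have "\<bar>arctan (real (Suc n) * c)\<bar> \<le> 2"
        using arctan_bounded[of "real (Suc n) * c"] pi_less_4 by auto
      then show "norm (arctan (real (Suc n) * c) / real (Suc n)) \<le> 2 * inverse (real (Suc n))"
        by (simp add: divide_inverse abs_mult)
    qed
    show "(\<lambda>n. 2 * inverse (real (Suc n))) \<longlonglongrightarrow> 0"
      using tendsto_mult[OF tendsto_const LIMSEQ_inverse_real_of_nat, of 2] by simp
  qed
  have P'_bd: "\<bar>P' n y\<bar> \<le> 1" for n y
    unfolding P'_def by (simp add: inverse_le_1_iff)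
  have P'_lim: "(\<lambda>n. P' n y) \<longlonglongrightarrow> (if y = 0 then 1 else 0)" for y
  proof (cases "y = 0")
    case False
    have "filterlim (\<lambda>n. real (Suc n) * \<bar>y\<bar>) at_top sequentially"
      using False filterlim_real_sequentially
      by (intro filterlim_at_top_mult_tendsto_pos[OF tendsto_const] filterlim_compose[OF filterlim_real_sequentially filterlim_Suc]) auto
    then have "filterlim (\<lambda>n. (real (Suc n) * \<bar>y\<bar>)\<^sup>2) at_top sequentially"
      by (rule filterlim_pow_at_top[rotated]) simp
    then have "filterlim (\<lambda>n. 1 + (real (Suc n) * y)\<^sup>2) at_top sequentially"
      by (intro filterlim_tendsto_add_at_top[OF tendsto_const]) (simp add: power_mult_distrib)
    then have "filterlim (\<lambda>n. 1 + (real (Suc n) * y)\<^sup>2) at_infinity sequentially"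
      by (rule filterlim_at_top_imp_at_infinity)
    then show ?thesis
      using False unfolding P'_def by (simp add: filterlim_compose[OF tendsto_inverse_0])
  qed (simp add: P'_def)
  have gm: "(\<lambda>t. indicator {a<..b} t *\<^sub>R g t) \<in> borel_measurable borel"
    using set_integrable_Ioc_g unfolding set_integrable_def
    by (metis borel_measurable_integrable measurable_lborel2)
  have gw: "integrable lborel (\<lambda>t. \<bar>indicator {a<..b} t *\<^sub>R g t\<bar>)"
    using set_integrable_Ioc_g unfolding set_integrable_def by (rule integrable_abs)
  have zm: "(\<lambda>t. (if w t = 0 then 1 else 0) * (indicator {a<..b} t *\<^sub>R g t)) \<in> borel_measurable lborel"
    using gm by measurable
  have pm: "(\<lambda>t. P' n (w t) * (indicator {a<..b} t *\<^sub>R g t)) \<in> borel_measurable lborel" for n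
    using gm meas by measurable
  have "(\<lambda>n. LBINT t. P' n (w t) * (indicator {a<..b} t *\<^sub>R g t)) \<longlonglongrightarrow>
      (LBINT t. (if w t = 0 then 1 else 0) * (indicator {a<..b} t *\<^sub>R g t))"
    and zi: "integrable lborel (\<lambda>t. (if w t = 0 then 1 else 0) * (indicator {a<..b} t *\<^sub>R g t))"
  proof -
    have lim: "AE t in lborel. (\<lambda>n. P' n (w t) * (indicator {a<..b} t *\<^sub>R g t)) \<longlonglongrightarrow>
        (if w t = 0 then 1 else 0) * (indicator {a<..b} t *\<^sub>R g t)"
      by (intro AE_I2 tendsto_mult P'_lim tendsto_const)
    have bd: "AE t in lborel. norm (P' n (w t) * (indicator {a<..b} t *\<^sub>R g t))
        \<le> \<bar>indicator {a<..b} t *\<^sub>R g t\<bar>" for n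
      using mult_right_mono[OF P'_bd] by (intro AE_I2) (force simp: abs_mult)
    show "(\<lambda>n. LBINT t. P' n (w t) * (indicator {a<..b} t *\<^sub>R g t)) \<longlonglongrightarrow>
        (LBINT t. (if w t = 0 then 1 else 0) * (indicator {a<..b} t *\<^sub>R g t))"
      by (rule integral_dominated_convergence[OF zm pm gw lim bd])
    show "integrable lborel (\<lambda>t. (if w t = 0 then 1 else 0) * (indicator {a<..b} t *\<^sub>R g t))"
      by (rule integrable_dominated_convergence[OF zm pm gw lim bd])
  qed
  moreover have "(\<lambda>n. LBINT t. P' n (w t) * (indicator {a<..b} t *\<^sub>R g t)) \<longlonglongrightarrow> 0"
    using tendsto_diff[OF arctan_lim arctan_lim, of "w b" "w a"]
    unfolding eq set_lebesgue_integral_def by (simp add: mult.left_commute)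
  ultimately have zero: "(LBINT t. (if w t = 0 then 1 else 0) * (indicator {a<..b} t *\<^sub>R g t)) = 0"
    using LIMSEQ_unique by blast
  have "(LBINT t:{a<..b}. if w t = 0 then 0 else g t) =
      (LBINT t. indicator {a<..b} t *\<^sub>R g t - (if w t = 0 then 1 else 0) * (indicator {a<..b} t *\<^sub>R g t))"
    unfolding set_lebesgue_integral_def by (rule Bochner_Integration.integral_cong) auto
  also have "\<dots> = (LBINT t:{a<..b}. g t)"
    using set_integrable_Ioc_g zi zero
    by (subst Bochner_Integration.integral_diff) (auto simp: set_integrable_def set_lebesgue_integral_def)
  finally show ?thesis using increment[OF \<open>a \<le> b\<close>] by simp
qed

end

subsection \<open>The continuous version of a density\<close>

lemma real_distribution_density:
  "prob_density f \<Longrightarrow> real_distribution (density lborel f)"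
  unfolding prob_density_def
  by (intro real_distribution.intro real_distribution_axioms.intro) auto

lemma distr_fun_diff:
  assumes f: "prob_density f" and "x \<le> y"
  shows "distr_fun f y - distr_fun f x = (LBINT t:{x<..y}. f t)"
proof -
  interpret real_distribution "density lborel f"
    by (rule real_distribution_density[OF f])
  have [measurable]: "f \<in> borel_measurable borel" using f by (simp add: prob_density_def)
  have "distr_fun f y - distr_fun f x = measure (density lborel f) {x<..y}"
    using cdf_diff_eq[of x y] \<open>x \<le> y\<close> by (cases "x = y") auto
  also have "\<dots> = enn2real (\<integral>\<^sup>+t. ennreal (indicator {x<..y} t *\<^sub>R f t) \<partial>lborel)"
    unfolding measure_def
    by (subst emeasure_density) (auto intro!: arg_cong[where f=enn2real] nn_integral_cong simp: indicator_def)
  also have "\<dots> = (LBINT t:{x<..y}. f t)"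
    unfolding set_lebesgue_integral_def using f
    by (intro integral_eq_nn_integral[symmetric]) (auto simp: prob_density_def)
  finally show ?thesis .
qed

lemma prob_density_integrable: "prob_density f \<Longrightarrow> integrable lborel f"
proof (rule integrableI_nonneg)
  assume f: "prob_density f"
  then interpret prob_space "density lborel f" by (simp add: prob_density_def)
  show "f \<in> borel_measurable lborel" "AE x in lborel. 0 \<le> f x"
    using f by (auto simp: prob_density_def)
  then show "(\<integral>\<^sup>+x. ennreal (f x) \<partial>lborel) < \<infinity>"
    using emeasure_space_1 by (simp add: emeasure_density cong: nn_integral_cong)
qed

lemma continuous_on_set_integral_Ioc:
  fixes g :: "real \<Rightarrow> real"
  assumes "locally_integrable g"
  shows "continuous_on {r..b} (\<lambda>y. LBINT t:{r<..y}. g t)"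
proof -
  have g: "set_integrable lborel {r..y} g" for y
    using assms by (auto simp: locally_integrable_def)
  have "continuous_on {r..b} (\<lambda>y. integral {r..y} g)"
    using g by (intro indefinite_integral_continuous_1 set_borel_integral_eq_integral)
  then show ?thesis
    using set_borel_integral_eq_integral(2)[OF g] by (simp add: set_integral_Ioc_Icc)
qed

text \<open>The continuous version of the density is found as the derivative of the distribution
  function, which to the right of any r is an integral of the continuous function
  \<open>C r + G r y\<close>.\<close>

lemma distr_fun_smooth:
  assumes f: "prob_density f" and wd: "has_weak_deriv f g"
  shows "\<exists>f0. (\<forall>x. (distr_fun f has_real_derivative f0 x) (at x)) \<and> integral_path g f0"
proof -
  let ?F = "distr_fun f"
  define G where "G r y = (LBINT t:{r<..y}. g t)" for r y
  have g: "locally_integrable g" using wd by (simp add: has_weak_deriv_def)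
  have cont_G: "continuous_on {r..b} (G r)" for r b
    unfolding G_def by (rule continuous_on_set_integral_Ioc[OF g])
  obtain C where C: "\<And>r d. r \<le> d \<Longrightarrow> (LBINT x:{r<..d}. f x) = (LBINT y:{r<..d}. C r + G r y)"
    using weak_deriv_primitive[OF prob_density_integrable[OF f] wd] unfolding G_def by metis
  have deriv_F: "(?F has_real_derivative C r + G r y) (at y)" if "r < y" for r y
  proof -
    have cont_CG: "continuous_on {r..b} (\<lambda>y. C r + G r y)" for b
      by (intro continuous_intros cont_G)
    have F: "?F r + integral {r..d} (\<lambda>y. C r + G r y) = ?F d" if "r \<le> d" for d
    proof -
      have "set_integrable lborel {r..d} (\<lambda>y. C r + G r y)"
        by (rule borel_integrable_atLeastAtMost'[OF cont_CG])
      from set_borel_integral_eq_integral(2)[OF this] show ?thesis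
        using distr_fun_diff[OF f that] C[OF that] by (simp add: set_integral_Ioc_Icc)
    qed
    have "((\<lambda>d. ?F r + integral {r..d} (\<lambda>y. C r + G r y)) has_real_derivative C r + G r y)
        (at y within {r..y + 1})"
      using integral_has_real_derivative[OF cont_CG, of y "y + 1"] that
      by (auto intro!: derivative_eq_intros)
    then have "(?F has_real_derivative C r + G r y) (at y within {r..y + 1})"
      by (rule has_field_derivative_transform_within[where d=1]) (use that F in auto)
    then show ?thesis
      using that by (simp add: at_within_Icc_at)
  qed
  \<comment> \<open>The constant \<open>C r\<close> depends on the base point, the derivative of the
    distribution function does not, so the formulas for all r agree. Base point x - 1 later places x
    inside the range of validity.\<close>
  define f0 where "f0 = deriv ?F"
  have f0: "f0 y = C r + G r y" if "r < y" for r y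
    unfolding f0_def using deriv_F[OF that] by (rule DERIV_imp_deriv)
  show ?thesis
  proof (intro exI[of _ f0] conjI allI)
    show "(?F has_real_derivative f0 x) (at x)" for x
      using deriv_F[of "x - 1" x] f0[of "x - 1" x] by simp
    show "integral_path g f0"
    proof
      show "locally_integrable g" by fact
      show "f0 y - f0 x = (LBINT t:{x<..y}. g t)" if "x \<le> y" for x y
        using f0[of "x - 1" x] f0[of "x - 1" y] that
          set_integral_Ioc_combine[OF g, of "x - 1" x y] by (simp add: G_def)
      have "continuous (at x) f0" for x
      proof -
        have "continuous_on {x - 1<..<x + 1} (\<lambda>y. C (x - 1) + G (x - 1) y)"
          by (intro continuous_intros continuous_on_subset[OF cont_G[of "x - 1" "x + 1"]]) auto
        then have "continuous_on {x - 1<..<x + 1} f0"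
          by (rule continuous_on_eq) (auto simp: f0)
        then show ?thesis by (simp add: continuous_on_eq_continuous_at)
      qed
      then show "continuous_on UNIV f0" by (simp add: continuous_at_imp_continuous_on)
    qed
  qed
qed

text \<open>Both densities give the same mass to half-open intervals, which generate the Borel sets;
  densities with respect to a sigma-finite measure are unique up to null sets.\<close>

lemma AE_eq_distr_fun_deriv:
  assumes f: "prob_density f" and deriv: "\<And>x. (distr_fun f has_real_derivative f0 x) (at x)"
    and cont: "continuous_on UNIV f0" and nonneg: "\<And>x. 0 \<le> f0 x"
  shows "AE x in lborel. f x = f0 x"
proof -
  interpret real_distribution "density lborel f"
    by (rule real_distribution_density[OF f])
  have fm: "f \<in> borel_measurable lborel" using f by (simp add: prob_density_def)
  have f0m: "f0 \<in> borel_measurable lborel"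
    using borel_measurable_continuous_onI[OF cont] by simp
  have Ioc: "emeasure (density lborel f0) {a<..b} = emeasure (density lborel f) {a<..b}" if "a \<le> b" for a b
  proof -
    have "emeasure (density lborel f0) {a<..b} = (\<integral>\<^sup>+x. ennreal (f0 x) * indicator {a<..b} x \<partial>lborel)"
      using f0m by (simp add: emeasure_density)
    also have "\<dots> = (\<integral>\<^sup>+x. ennreal (f0 x) * indicator {a..b} x \<partial>lborel)"
      using AE_lborel_singleton[of a]
      by (intro nn_integral_cong_AE) (auto elim!: eventually_mono simp: indicator_def)
    also have "\<dots> = ennreal (distr_fun f b - distr_fun f a)"
      using f0m deriv nonneg that by (intro nn_integral_FTC_Icc) auto
    also have "\<dots> = emeasure (density lborel f) {a<..b}"
      using that by (simp add: emeasure_Ioc)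
    finally show ?thesis .
  qed
  have "density lborel f0 = density lborel f"
  proof (rule measure_eqI_generator_eq[where \<Omega>=UNIV])
    show "(\<Union>i. {- real (i::nat)<..real i}) = UNIV" by (rule UN_Ioc_eq_UNIV)
    fix X assume "X \<in> range (\<lambda>(a, b). {a<..b::real})"
    then obtain a b where "X = {a<..b}" by auto
    then show "emeasure (density lborel f0) X = emeasure (density lborel f) X"
      using Ioc[of a b] by (cases "a \<le> b") auto
  qed (auto simp: Ioc borel_sigma_sets_Ioc Int_stable_def emeasure_Ioc)
  then have "AE x in lborel. ennreal (f x) = ennreal (f0 x)"
    using fm f0m by (subst sigma_finite_measure.density_unique_iff[OF sigma_finite_lborel, symmetric]) auto
  then show ?thesis
    using f nonneg by (auto simp: prob_density_def elim!: eventually_mono)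
qed

subsection \<open>Quantile functions\<close>

context
  fixes M :: "real measure"
  assumes M: "real_distribution M"
begin

interpretation cdf_distribution M
  using M by (rule cdf_distribution.intro)

lemma quantile_eq_I: "quantile M = I"
  by (simp add: quantile_def fun_eq_iff)

lemma quantile_le_iff: "u \<in> {0<..<1} \<Longrightarrow> quantile M u \<le> x \<longleftrightarrow> u \<le> cdf M x"
  using pseudoinverse[of u x] by (simp add: quantile_eq_I)

lemma mono_on_quantile: "mono_on {0<..<1} (quantile M)"
  using mono_I by (simp add: quantile_eq_I)

text \<open>Continuity rules out a jump across level u: left of the quantile the distribution
  function is at most u, and the left limit carries this bound to the quantile.\<close>

lemma cdf_quantile:
  assumes "continuous_on UNIV (cdf M)" "u \<in> {0<..<1}"
  shows "cdf M (quantile M u) = u"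
proof (rule antisym)
  show "u \<le> cdf M (quantile M u)"
    using quantile_le_iff[OF assms(2)] by blast
  have "(cdf M \<longlongrightarrow> cdf M (quantile M u)) (at_left (quantile M u))"
    using assms(1) by (simp add: continuous_on_def filterlim_at_split tendsto_at_iff_tendsto_nhds_within
        Lim_at_imp_Lim_at_within)
  moreover have "cdf M x \<le> u" if "x < quantile M u" for x
    using quantile_le_iff[OF assms(2), of x] that by linarith
  then have "eventually (\<lambda>x. cdf M x \<le> u) (at_left (quantile M u))"
    unfolding eventually_at_filter by (intro always_eventually) auto
  ultimately show "cdf M (quantile M u) \<le> u"
    by (rule tendsto_upperbound) simp
qed

lemma measurable_quantile: "quantile M \<in> borel_measurable (restrict_space borel {0<..<1})"
  by (intro borel_measurable_mono_on_fnc mono_on_quantile)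

text \<open>The quantile transform of the uniform distribution; it exchanges integrals over levels u
  for integrals over observations x.\<close>

lemma distr_quantile: "distr (restrict_space lborel {0<..<1}) borel (quantile M) = M"
  using distr_I_eq_M by (simp add: quantile_eq_I)

lemma measurable_quantile_lborel: "quantile M \<in> borel_measurable (restrict_space lborel {0<..<1})"
  using measurable_quantile by (simp cong: measurable_cong_sets add: sets_restrict_space)

lemma
  fixes h :: "real \<Rightarrow> real"
  assumes h: "h \<in> borel_measurable borel"
  shows set_integrable_quantile_iff:
      "set_integrable lborel {0<..<1} (\<lambda>u. h (quantile M u)) \<longleftrightarrow> integrable M h"
    and set_integral_quantile: "(LBINT u:{0<..<1}. h (quantile M u)) = (\<integral>x. h x \<partial>M)"
proof -
  show "set_integrable lborel {0<..<1} (\<lambda>u. h (quantile M u)) \<longleftrightarrow> integrable M h"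
    using integrable_distr_eq[OF measurable_quantile_lborel h]
    by (simp add: distr_quantile integrable_restrict_space set_integrable_def)
  show "(LBINT u:{0<..<1}. h (quantile M u)) = (\<integral>x. h x \<partial>M)"
    using integral_distr[OF measurable_quantile_lborel h]
    by (simp add: distr_quantile integral_restrict_space set_lebesgue_integral_def)
qed

lemma set_nn_integral_quantile:
  assumes h: "h \<in> borel_measurable borel"
  shows "(\<integral>\<^sup>+u\<in>{0<..<1}. h (quantile M u) \<partial>lborel) = (\<integral>\<^sup>+x. h x \<partial>M)"
  using nn_integral_distr[OF measurable_quantile_lborel, of h] h
  by (simp add: distr_quantile nn_integral_restrict_space)

end

subsection \<open>Tail integrals of the score\<close>

lemma mono_deriv_nonneg:
  fixes F :: "real \<Rightarrow> real"
  assumes "mono F" "(F has_real_derivative D) (at x)"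
  shows "0 \<le> D"
proof (rule ccontr)
  assume "\<not> 0 \<le> D"
  then obtain d where "0 < d" "\<And>h. 0 < h \<Longrightarrow> h < d \<Longrightarrow> F (x + h) < F x"
    using DERIV_neg_dec_right[OF assms(2)] by auto
  from this(2)[of "d / 2"] \<open>0 < d\<close> monoD[OF assms(1), of x "x + d / 2"] show False by auto
qed

lemma set_integral_Ioi_LIMSEQ:
  fixes h :: "real \<Rightarrow> real"
  assumes h: "integrable lborel h" and b: "filterlim b at_top sequentially"
  shows "(\<lambda>n. LBINT x:{y<..b n}. h x) \<longlonglongrightarrow> (LBINT x:{y<..}. h x)"
  unfolding set_lebesgue_integral_def
proof (rule integral_dominated_convergence[where w="\<lambda>x. \<bar>h x\<bar>"])
  have "(\<lambda>n. indicator {y<..b n} x *\<^sub>R h x) \<longlonglongrightarrow> indicator {y<..} x *\<^sub>R h x" for x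
  proof (rule tendsto_eventually)
    have "eventually (\<lambda>n. x \<le> b n) sequentially"
      using b by (simp add: filterlim_at_top)
    then show "eventually (\<lambda>n. indicator {y<..b n} x *\<^sub>R h x = indicator {y<..} x *\<^sub>R h x) sequentially"
      by eventually_elim (auto simp: indicator_def)
  qed
  then show "AE x in lborel. (\<lambda>n. indicator {y<..b n} x *\<^sub>R h x) \<longlonglongrightarrow> indicator {y<..} x *\<^sub>R h x"
    by simp
qed (use h in \<open>auto simp: indicator_def\<close>)

lemma set_integral_Ioi_at_bot_LIMSEQ:
  fixes h :: "real \<Rightarrow> real"
  assumes h: "integrable lborel h" and a: "filterlim a at_bot sequentially"
  shows "(\<lambda>n. LBINT x:{a n<..}. h x) \<longlonglongrightarrow> (LBINT x. h x)"
  unfolding set_lebesgue_integral_def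
proof (rule integral_dominated_convergence[where w="\<lambda>x. \<bar>h x\<bar>"])
  have "(\<lambda>n. indicator {a n<..} x *\<^sub>R h x) \<longlonglongrightarrow> h x" for x
  proof (rule tendsto_eventually)
    have "eventually (\<lambda>n. a n < x) sequentially"
      using a by (simp add: filterlim_at_bot_dense)
    then show "eventually (\<lambda>n. indicator {a n<..} x *\<^sub>R h x = h x) sequentially"
      by eventually_elim (auto simp: indicator_def)
  qed
  then show "AE x in lborel. (\<lambda>n. indicator {a n<..} x *\<^sub>R h x) \<longlonglongrightarrow> h x"
    by simp
qed (use h in \<open>auto simp: indicator_def\<close>)

text \<open>On each unit interval the mean value theorem finds a point where the density equals an
  increment of the distribution function, and these increments vanish far out. Sequences suffice,
  since the tail integrals to be evaluated converge anyway.\<close>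

lemma (in real_distribution) cdf_deriv_LIMSEQ_0:
  assumes deriv: "\<And>x. (cdf M has_real_derivative f0 x) (at x)"
  obtains a b where "filterlim b at_top sequentially" "(\<lambda>n. f0 (b n)) \<longlonglongrightarrow> 0"
    "filterlim a at_bot sequentially" "(\<lambda>n. f0 (a n)) \<longlonglongrightarrow> 0"
proof -
  have ex: "\<exists>z. x < z \<and> z < x + 1 \<and> f0 z = cdf M (x + 1) - cdf M x" for x
    using MVT2[of x "x + 1" "cdf M" f0] deriv by auto
  obtain z where z: "\<And>x. x < z x" "\<And>x. z x < x + 1" "\<And>x. f0 (z x) = cdf M (x + 1) - cdf M x"
    using ex by metis
  have 1: "filterlim (\<lambda>n. real n) at_top sequentially" by (rule filterlim_real_sequentially)
  have 2: "filterlim (\<lambda>n. real n + 1) at_top sequentially"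
    using filterlim_tendsto_add_at_top[OF tendsto_const 1, of 1] by (simp add: add.commute)
  have 3: "filterlim (\<lambda>n. - real n) at_bot sequentially"
    using 1 by (simp add: filterlim_uminus_at_bot)
  have 4: "filterlim (\<lambda>n. - real n + 1) at_bot sequentially"
  proof (subst filterlim_uminus_at_bot)
    show "filterlim (\<lambda>n. - (- real n + 1)) at_top sequentially"
      using filterlim_tendsto_add_at_top[OF tendsto_const 1, of "- 1"] by simp
  qed
  show thesis
  proof
    show "filterlim (\<lambda>n. z (real n)) at_top sequentially"
      using 1 by (rule filterlim_at_top_mono) (rule always_eventually, rule allI, rule less_imp_le, rule z(1))
    show "(\<lambda>n. f0 (z (real n))) \<longlonglongrightarrow> 0"
      unfolding z
      using tendsto_diff[OF filterlim_compose[OF cdf_lim_at_top_prob 2]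
          filterlim_compose[OF cdf_lim_at_top_prob 1]] by simp
    show "filterlim (\<lambda>n. z (- real n)) at_bot sequentially"
      unfolding filterlim_at_bot
    proof
      fix Z
      have "eventually (\<lambda>n. - real n + 1 \<le> Z) sequentially"
        using 4 by (simp add: filterlim_at_bot)
      then show "eventually (\<lambda>n. z (- real n) \<le> Z) sequentially"
        by eventually_elim (use z(2) in \<open>blast intro: less_imp_le less_le_trans\<close>)
    qed
    show "(\<lambda>n. f0 (z (- real n))) \<longlonglongrightarrow> 0"
      unfolding z
      using tendsto_diff[OF filterlim_compose[OF cdf_lim_at_bot 4]
          filterlim_compose[OF cdf_lim_at_bot 3]] by simp
  qed
qed

text \<open>Density times score is minus the derivative of \<open>f0\<close>, so the integral beyond
  x is \<open>f0 x\<close> minus a value far out that tends to 0. The quantile transform carries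
  this from the line to levels in (0,1).\<close>

lemma location_score_tails:
  assumes "f \<in> class_F"
  defines "L \<equiv> \<lambda>u. location_score f (quantile_fun f u)"
  shows location_score_integrable: "set_integrable lborel {0<..<1} L"
    and location_score_integral: "(LBINT u:{0<..<1}. L u) = 0"
    and location_score_tail_nonneg: "s \<in> {0<..<1} \<Longrightarrow> 0 \<le> (LBINT u:{s..<1}. L u)"
proof -
  define g where "g = weak_deriv f"
  let ?M = "density lborel f"
  from assms(1) have f: "prob_density f" and fin: "fisher_info f < \<infinity>"
    and "\<exists>g. has_weak_deriv f g"
    by (auto simp: class_F_def)
  from someI_ex[OF this(3)] have wd: "has_weak_deriv f g"
    by (simp add: g_def weak_deriv_def)
  interpret real_distribution ?M by (rule real_distribution_density[OF f])
  note M = real_distribution_density[OF f]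
  have [measurable]: "f \<in> borel_measurable borel" and f_nonneg: "\<And>x. 0 \<le> f x"
    using f by (auto simp: prob_density_def)
  have [measurable]: "g \<in> borel_measurable borel"
    using wd by (auto simp: has_weak_deriv_def intro: borel_measurable_locally_integrable)
  have ls_def: "location_score f = (\<lambda>x. - g x / f x)"
    by (auto simp: location_score_def g_def)
  have ls[measurable]: "location_score f \<in> borel_measurable borel"
    unfolding ls_def by measurable
  obtain f0 where deriv: "\<And>x. (distr_fun f has_real_derivative f0 x) (at x)"
    and path: "integral_path g f0"
    using distr_fun_smooth[OF f wd] by blast
  interpret integral_path g f0 by fact
  have "0 \<le> f0 x" for x
    using mono_deriv_nonneg[OF monoI deriv] cdf_nondecreasing by blast
  note f0_nonneg = this
  have f_eq: "AE x in lborel. f x = f0 x"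
    by (rule AE_eq_distr_fun_deriv[OF f deriv cont f0_nonneg])
  have cont_F: "continuous_on UNIV (distr_fun f)"
    using deriv by (blast intro: DERIV_continuous_on has_field_derivative_at_within)
  have "(\<integral>\<^sup>+x. ennreal ((location_score f x)\<^sup>2) \<partial>?M) < \<infinity>"
    using fin set_nn_integral_quantile[OF M, of "\<lambda>x. ennreal ((location_score f x)\<^sup>2)"]
    by (simp add: fisher_info_def)
  then have "integrable ?M (\<lambda>x. (location_score f x)\<^sup>2)"
    by (intro integrableI_nonneg) auto
  then have "integrable ?M (\<lambda>x. 1 + (location_score f x)\<^sup>2)"
    by (intro Bochner_Integration.integrable_add) auto
  then have ls_int: "integrable ?M (location_score f)"
  proof (rule Bochner_Integration.integrable_bound)
    have "\<bar>y\<bar> \<le> 1 + y\<^sup>2" for y :: real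
      using zero_le_power2[of "\<bar>y\<bar> - 1"] zero_le_power2[of y]
      by (simp add: power2_diff)
    then show "AE x in ?M. norm (location_score f x) \<le> norm (1 + (location_score f x)\<^sup>2)"
      by (intro AE_I2) simp
  qed auto
  then show "set_integrable lborel {0<..<1} L"
    using set_integrable_quantile_iff[OF M ls] by (simp add: L_def)
  \<comment> \<open>Where the density vanishes, its product with the score is 0 whatever g is there;
    h is g cut off accordingly. By \<open>integral_nonzero_set\<close> the cut-off keeps the
    increments of \<open>f0\<close>.\<close>
  define h where "h x = (if f0 x = 0 then 0 else g x)" for x
  have hm: "h \<in> borel_measurable borel" unfolding h_def by measurable
  have fls: "AE x in lborel. f x *\<^sub>R (k x * location_score f x) = k x * - h x" for k :: "real \<Rightarrow> real"
    using f_eq by eventually_elim (auto simp: h_def ls_def)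
  have to_h: "(\<integral>x. k x * location_score f x \<partial>?M) = (LBINT x. k x * - h x)"
    if [measurable]: "k \<in> borel_measurable borel" for k
  proof -
    have "(\<integral>x. k x * location_score f x \<partial>?M) = (LBINT x. f x *\<^sub>R (k x * location_score f x))"
      by (rule integral_density) (auto simp: f_nonneg)
    also have "\<dots> = (LBINT x. k x * - h x)"
      using fls hm by (intro integral_cong_AE) auto
    finally show ?thesis .
  qed
  have "integrable lborel (\<lambda>x. f x *\<^sub>R (1 * location_score f x))"
    using ls_int integrable_density[of "location_score f" lborel f] by (simp add: f_nonneg)
  then have "integrable lborel (\<lambda>x. 1 * - h x)"
    by (rule integrable_cong_AE_imp) (use fls[of "\<lambda>_. 1"] hm in \<open>auto elim: eventually_mono\<close>)
  then have h_int: "integrable lborel h" by simp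
  obtain a b where ab: "filterlim b at_top sequentially" "(\<lambda>n. f0 (b n)) \<longlonglongrightarrow> 0"
    "filterlim a at_bot sequentially" "(\<lambda>n. f0 (a n)) \<longlonglongrightarrow> 0"
    by (rule cdf_deriv_LIMSEQ_0[OF deriv])
  have tail: "(LBINT x:{y<..}. h x) = - f0 y" for y
  proof (rule LIMSEQ_unique)
    show "(\<lambda>n. LBINT x:{y<..b n}. h x) \<longlonglongrightarrow> (LBINT x:{y<..}. h x)"
      by (rule set_integral_Ioi_LIMSEQ[OF h_int ab(1)])
    have "eventually (\<lambda>n. y \<le> b n) sequentially"
      using ab(1) by (simp add: filterlim_at_top)
    then have ev: "eventually (\<lambda>n. f0 (b n) - f0 y = (LBINT x:{y<..b n}. h x)) sequentially"
      by eventually_elim (simp add: integral_nonzero_set h_def)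
    have "(\<lambda>n. f0 (b n) - f0 y) \<longlonglongrightarrow> - f0 y"
      using tendsto_diff[OF ab(2) tendsto_const, of "f0 y"] by simp
    then show "(\<lambda>n. LBINT x:{y<..b n}. h x) \<longlonglongrightarrow> - f0 y"
      using ev by (rule Lim_transform_eventually)
  qed
  have total: "(LBINT x. h x) = 0"
  proof (rule LIMSEQ_unique)
    show "(\<lambda>n. LBINT x:{a n<..}. h x) \<longlonglongrightarrow> (LBINT x. h x)"
      by (rule set_integral_Ioi_at_bot_LIMSEQ[OF h_int ab(3)])
    show "(\<lambda>n. LBINT x:{a n<..}. h x) \<longlonglongrightarrow> 0"
      unfolding tail using tendsto_minus[OF ab(4)] by simp
  qed
  show "(LBINT u:{0<..<1}. L u) = 0"
    using set_integral_quantile[OF M ls] to_h[of "\<lambda>_. 1"] total by (simp add: L_def)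
  assume s: "s \<in> {0<..<1}"
  define q where "q = quantile_fun f s"
  \<comment> \<open>The quantile inequality at level s is applied to the point
    \<open>quantile_fun f u\<close>, where the distribution function returns u by continuity. Levels
    from s on therefore correspond exactly to observations from q on.\<close>
  have iff: "s \<le> u \<longleftrightarrow> q \<le> quantile_fun f u" if "u \<in> {0<..<1}" for u
    unfolding q_def quantile_le_iff[OF M s] cdf_quantile[OF M cont_F that] ..
  have "(LBINT u:{s..<1}. L u) =
      (LBINT u:{0<..<1}. indicator {q..} (quantile_fun f u) * location_score f (quantile_fun f u))"
    unfolding set_lebesgue_integral_def L_def
  proof (rule Bochner_Integration.integral_cong[OF refl])
    fix u
    show "indicator {s..<1} u *\<^sub>R location_score f (quantile_fun f u) =
        indicator {0<..<1} u *\<^sub>R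
          (indicator {q..} (quantile_fun f u) * location_score f (quantile_fun f u))"
      using iff[of u] s by (cases "u \<in> {0<..<1}") (auto simp: indicator_def)
  qed
  also have "\<dots> = (LBINT x. indicator {q..} x * - h x)"
    by (subst set_integral_quantile[OF M]) (auto simp: to_h)
  also have "\<dots> = - (LBINT x:{q..}. h x)"
    by (simp add: set_lebesgue_integral_def)
  also have "(LBINT x:{q..}. h x) = (LBINT x:{q<..}. h x)"
    by (rule set_integral_discrete_difference[where X="{q}"]) auto
  finally show "0 \<le> (LBINT u:{s..<1}. L u)"
    using f0_nonneg[of q] by (simp add: tail)
qed

subsection \<open>Monotone weights\<close>

text \<open>An upper section of the unit interval differs from \<open>{s..<1}\<close>, with s its
  infimum, at most in the null set {s}. For s = 0 it is the whole interval, where the integral is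
  0.\<close>

lemma set_integral_upset_nonneg:
  fixes L :: "real \<Rightarrow> real"
  assumes total: "(LBINT u:{0<..<1}. L u) = 0"
    and tail: "\<And>s. s \<in> {0<..<1} \<Longrightarrow> 0 \<le> (LBINT u:{s..<1}. L u)"
    and A: "A \<subseteq> {0<..<1}" "\<And>u v. u \<in> A \<Longrightarrow> u \<le> v \<Longrightarrow> v < 1 \<Longrightarrow> v \<in> A"
  shows "0 \<le> (LBINT u:A. L u)"
proof (cases "A = {}")
  case False
  define s where "s = Inf A"
  have bdd: "bdd_below A" using A(1) by (intro bdd_belowI[of _ 0]) auto
  have s_le: "s \<le> u" if "u \<in> A" for u
    unfolding s_def using that bdd by (rule cInf_lower)
  have upper: "v \<in> A" if "s < v" "v < 1" for v
    using cInf_lessD[OF False, of v] that A(2) by (auto simp: s_def)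
  have "0 \<le> s"
    unfolding s_def using A(1) by (intro cInf_greatest[OF False]) auto
  moreover obtain u where "u \<in> A" using False by blast
  with A(1) s_le[of u] have "s < 1" by auto
  ultimately consider "s = 0" | "s \<in> {0<..<1}" by fastforce
  then show ?thesis
  proof cases
    case 1
    then have "{0<..<1} \<subseteq> A" using upper by auto
    with A(1) have "A = {0<..<1}" by (rule antisym)
    with total show ?thesis by simp
  next
    case 2
    have "(LBINT u:A. L u) = (LBINT u:{s..<1}. L u)"
    proof (rule set_integral_discrete_difference[where X="{s}"])
      have "A \<subseteq> {s..<1}" using A(1) s_le by auto
      moreover have "{s..<1} \<subseteq> A \<union> {s}"
      proof
        fix v assume "v \<in> {s..<1}"
        then show "v \<in> A \<union> {s}" using upper[of v] by (cases "v = s") auto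
      qed
      ultimately show "A - {s..<1} \<union> ({s..<1} - A) \<subseteq> {s}" by blast
    qed auto
    with tail[OF 2] show ?thesis by simp
  qed
qed (simp add: set_lebesgue_integral_def)

text \<open>By the layer-cake decomposition, a monotone weight is a superposition of indicator
  functions of upper sections of the unit interval.\<close>

lemma set_integral_mono_weight_nonneg:
  fixes E L :: "real \<Rightarrow> real"
  assumes L: "set_integrable lborel {0<..<1} L"
    and total: "(LBINT u:{0<..<1}. L u) = 0"
    and tail: "\<And>s. s \<in> {0<..<1} \<Longrightarrow> 0 \<le> (LBINT u:{s..<1}. L u)"
    and mono: "mono_on {0<..<1} E"
    and EL: "set_integrable lborel {0<..<1} (\<lambda>u. E u * L u)"
  shows "0 \<le> (LBINT u:{0<..<1}. E u * L u)"
proof -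
  let ?I = "{0<..<1::real}"
  define e where "e u = indicator ?I u * E u" for u
  define l where "l u = indicator ?I u * L u" for u
  \<comment> \<open>The weight may take both signs, hence a signed kernel. It integrates over t to
    \<open>e u\<close>, and its absolute value to \<open>\<bar>e u\<bar>\<close>, so integrability
    of the product of E and L is just what Fubini requires.\<close>
  define k where "k u t = (if 0 < t \<and> t \<le> e u then 1 else 0) - (if e u < t \<and> t \<le> 0 then 1 else 0::real)" for u t
  have "E \<in> borel_measurable (restrict_space borel ?I)"
    using mono by (rule borel_measurable_mono_on_fnc)
  then have em[measurable]: "e \<in> borel_measurable borel"
    unfolding e_def by (subst (asm) borel_measurable_restrict_space_iff) auto
  have l_int: "integrable lborel l"
    using L by (simp add: set_integrable_def l_def[abs_def])
  then have lm[measurable]: "l \<in> borel_measurable borel" by auto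
  have el_int: "integrable lborel (\<lambda>u. e u * l u)"
    using EL unfolding set_integrable_def
    by (rule Bochner_Integration.integrable_cong[THEN iffD1, rotated 2]) (auto simp: e_def l_def indicator_def)
  have k_eq: "k u = (\<lambda>t. indicator {0<..e u} t - indicator {e u<..0} t)" for u
    by (auto simp: k_def indicator_def)
  have abs_k_eq: "(\<lambda>t. \<bar>k u t\<bar>) = (\<lambda>t. indicator {0<..e u} t + indicator {e u<..0} t)" for u
    by (auto simp: k_def indicator_def)
  have ind_int: "integrable lborel (indicator {a<..b} :: real \<Rightarrow> real)" for a b :: real
    by (intro integrable_real_indicator) (auto simp: emeasure_lborel_Ioc_finite)
  have k_int: "integrable lborel (k u)" for u
    unfolding k_eq by (intro Bochner_Integration.integrable_diff ind_int)
  have k_integral: "(LBINT t. k u t) = e u" for u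
    unfolding k_eq by (subst Bochner_Integration.integral_diff[OF ind_int ind_int])
      (cases "0 \<le> e u"; simp)
  have abs_k_integral: "(LBINT t. \<bar>k u t\<bar>) = \<bar>e u\<bar>" for u
    unfolding abs_k_eq by (subst Bochner_Integration.integral_add[OF ind_int ind_int])
      (cases "0 \<le> e u"; simp)
  have int: "integrable (lborel \<Otimes>\<^sub>M lborel) (\<lambda>(u, t). k u t * l u)"
  proof (rule lborel_pair.Fubini_integrable)
    show "(\<lambda>(u, t). k u t * l u) \<in> borel_measurable (lborel \<Otimes>\<^sub>M lborel)"
      unfolding k_def by measurable
    show "integrable lborel (\<lambda>u. LBINT t. norm (case (u, t) of (u, t) \<Rightarrow> k u t * l u))"
      using integrable_abs[OF el_int] by (simp add: abs_mult abs_k_integral)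
    show "AE u in lborel. integrable lborel (\<lambda>t. case (u, t) of (u, t) \<Rightarrow> k u t * l u)"
      using k_int by simp
  qed
  have "0 \<le> (LBINT u. k u t * l u)" for t
  proof -
    define A where "A = {u \<in> ?I. t \<le> E u}"
    have "A = {u \<in> space borel. t \<le> e u} \<inter> ?I" by (auto simp: A_def e_def)
    then have Am: "A \<in> sets borel" by simp
    have "0 \<le> (LBINT u:A. L u)"
    proof (rule set_integral_upset_nonneg[OF total tail])
      fix u v assume "u \<in> A" "u \<le> v" "v < 1"
      then show "v \<in> A"
        using mono_onD[OF mono, of u v] by (auto simp: A_def)
    qed (auto simp: A_def)
    also have "(LBINT u:A. L u) = (LBINT u. k u t * l u)"
    proof (cases "0 < t")
      case True
      then show ?thesis unfolding set_lebesgue_integral_def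
        by (intro Bochner_Integration.integral_cong) (auto simp: k_def A_def e_def l_def indicator_def)
    next
      case False
      \<comment> \<open>For t \<le> 0 the kernel on the unit interval is the indicator of A minus 1,
        and the constant contributes nothing because L has total integral 0.\<close>
      have A_int: "integrable lborel (\<lambda>u. indicator A u * l u)"
        using integrable_mult_indicator[OF _ l_int, of A] Am by simp
      have "(LBINT u. k u t * l u) = (LBINT u. indicator A u * l u - l u)"
        using False by (intro Bochner_Integration.integral_cong) (auto simp: k_def A_def e_def l_def indicator_def)
      also have "\<dots> = (LBINT u. indicator A u * l u)"
        using total l_int A_int
        by (simp add: set_lebesgue_integral_def l_def[symmetric])
      also have "\<dots> = (LBINT u:A. L u)"
        unfolding set_lebesgue_integral_def
        by (intro Bochner_Integration.integral_cong) (auto simp: A_def l_def indicator_def)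
      finally show ?thesis by simp
    qed
    finally show ?thesis .
  qed
  then have "0 \<le> (LBINT t. LBINT u. k u t * l u)"
    by (rule Bochner_Integration.integral_nonneg)
  also have "\<dots> = (LBINT u. LBINT t. k u t * l u)"
    by (rule lborel_pair.Fubini_integral[OF int])
  also have "\<dots> = (LBINT u. e u * l u)"
    using k_int by (simp add: k_integral)
  also have "\<dots> = (LBINT u:?I. E u * L u)"
    unfolding set_lebesgue_integral_def
    by (intro Bochner_Integration.integral_cong) (auto simp: e_def l_def indicator_def)
  finally show ?thesis .
qed

subsection \<open>Symmetric densities\<close>

lemma measure_singleton_density: "f \<in> borel_measurable borel \<Longrightarrow> measure (density lborel f) {x::real} = 0"
  unfolding measure_def
  by (subst emeasure_density)
     (auto simp: nn_integral_0_iff_AE intro!: AE_mp[OF AE_lborel_singleton[of x]] AE_I2)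

lemma continuous_on_distr_fun: "prob_density f \<Longrightarrow> continuous_on UNIV (distr_fun f)"
proof -
  assume f: "prob_density f"
  then interpret real_distribution "density lborel f" by (rule real_distribution_density)
  have "isCont (distr_fun f) x" for x
    using f by (subst isCont_cdf, intro measure_singleton_density) (auto simp: prob_density_def)
  then show ?thesis by (simp add: continuous_at_imp_continuous_on)
qed

text \<open>Reflection exchanges the two closed half-lines, and the origin, which they share,
  carries no mass.\<close>

lemma distr_fun_0_symmetric:
  assumes f: "prob_density f" and sym: "symmetric_density f"
  shows "distr_fun f 0 = 1 / 2"
proof -
  let ?M = "density lborel f"
  interpret real_distribution ?M by (rule real_distribution_density[OF f])
  have [measurable]: "f \<in> borel_measurable borel" using f by (simp add: prob_density_def)
  have "emeasure ?M {..0} = (\<integral>\<^sup>+x. ennreal (f x) * indicator {..0} x \<partial>lborel)"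
    by (simp add: emeasure_density)
  also have "\<dots> = (\<integral>\<^sup>+x. ennreal (f (- x)) * indicator {..0} (- x) \<partial>lborel)"
    using nn_integral_real_affine[of "\<lambda>x. ennreal (f x) * indicator {..0} x" "- 1" 0] by simp
  also have "\<dots> = (\<integral>\<^sup>+x. ennreal (f x) * indicator {0..} x \<partial>lborel)"
    using sym by (intro nn_integral_cong) (simp add: symmetric_density_def indicator_def)
  also have "\<dots> = emeasure ?M {0..}"
    by (simp add: emeasure_density)
  finally have "measure ?M {..0} = measure ?M {0..}"
    by (simp add: measure_def)
  also have "\<dots> = measure ?M {0} + measure ?M {0<..}"
  proof -
    have "{0..} = {0::real} \<union> {0<..}" by auto
    then show ?thesis by (simp only:) (rule finite_measure_Union, auto)
  qed
  also have "\<dots> = measure ?M (space ?M - {..0})"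
    by (simp add: measure_singleton_density Compl_eq_Diff_UNIV[symmetric] Compl_atMost)
  also have "\<dots> = 1 - measure ?M {..0}"
    by (rule prob_compl) auto
  finally show ?thesis by (simp add: cdf_def)
qed

lemma quantile_fun_sign:
  assumes f: "prob_density f" and sym: "symmetric_density f" and u: "u \<in> {0<..<1}"
  shows quantile_fun_nonneg: "1 / 2 < u \<Longrightarrow> 0 \<le> quantile_fun f u"
    and quantile_fun_nonpos: "u \<le> 1 / 2 \<Longrightarrow> quantile_fun f u \<le> 0"
proof -
  note iff = quantile_le_iff[OF real_distribution_density[OF f] u]
  show "u \<le> 1 / 2 \<Longrightarrow> quantile_fun f u \<le> 0"
    using iff[of 0] by (simp add: distr_fun_0_symmetric[OF f sym])
  assume "1 / 2 < u"
  then have "\<not> quantile_fun f u \<le> 0"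
    using iff[of 0] by (simp add: distr_fun_0_symmetric[OF f sym])
  then show "0 \<le> quantile_fun f u" by simp
qed

subsection \<open>The normal scores\<close>

lemma prob_density_std_normal: "prob_density std_normal_density"
  using prob_space_normal_density[of 1 0] by (simp add: prob_density_def)

lemma symmetric_density_std_normal: "symmetric_density std_normal_density"
  by (simp add: symmetric_density_def std_normal_density_def)

lemma std_normal_density_le: "std_normal_density x \<le> 1 / sqrt (2 * pi)"
  by (simp add: std_normal_density_def divide_right_mono)

lemma distr_fun_std_normal_increment:
  assumes "x \<le> y"
  shows "distr_fun std_normal_density y - distr_fun std_normal_density x \<le> (y - x) / sqrt (2 * pi)"
proof -
  have "distr_fun std_normal_density y - distr_fun std_normal_density x = (LBINT t:{x<..y}. std_normal_density t)"
    by (rule distr_fun_diff[OF prob_density_std_normal assms])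
  also have "\<dots> \<le> (LBINT t:{x<..y}. 1 / sqrt (2 * pi))"
    using prob_density_integrable[OF prob_density_std_normal] std_normal_density_le
      integrable_mult_indicator[of "{x<..y}" lborel std_normal_density]
    by (intro set_integral_mono) (auto simp: set_integrable_def emeasure_lborel_Ioc_finite intro!: integrable_mult_left)
  also have "\<dots> = (y - x) / sqrt (2 * pi)"
    using assms by (simp add: set_lebesgue_integral_def)
  finally show ?thesis .
qed

lemma distr_fun_J_vdW: "u \<in> {0<..<1} \<Longrightarrow> distr_fun std_normal_density (J_vdW u) = u"
  unfolding J_vdW_def
  by (intro cdf_quantile real_distribution_density continuous_on_distr_fun prob_density_std_normal)

definition score_gap :: "real \<Rightarrow> real" where
  "score_gap u = J_vdW u / sqrt (2 * pi) - J_W u"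

text \<open>The distribution function undoes \<open>J_vdW\<close>, so the increment bound between
  the normal quantiles of u and v has v - u on its left; rearranged, it is the claim.\<close>

lemma mono_on_score_gap: "mono_on {0<..<1} score_gap"
proof (rule mono_onI)
  fix u v :: real assume uv: "u \<in> {0<..<1}" "v \<in> {0<..<1}" "u \<le> v"
  have "J_vdW u \<le> J_vdW v"
    unfolding J_vdW_def using real_distribution_density[OF prob_density_std_normal] uv
    by (intro mono_onD[OF mono_on_quantile]) auto
  from distr_fun_std_normal_increment[OF this] show "score_gap u \<le> score_gap v"
    using uv by (simp add: distr_fun_J_vdW score_gap_def J_W_def diff_divide_distrib)
qed

text \<open>The same increment bound, now between 0, where the distribution function equals 1/2, and
  \<open>J_vdW u\<close>.\<close>

lemma score_gap_sign:
  assumes u: "u \<in> {0<..<1}"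
  shows score_gap_nonneg: "1 / 2 < u \<Longrightarrow> 0 \<le> score_gap u"
    and score_gap_nonpos: "u \<le> 1 / 2 \<Longrightarrow> score_gap u \<le> 0"
proof -
  note sign = quantile_fun_sign[OF prob_density_std_normal symmetric_density_std_normal u, folded J_vdW_def]
  note half = distr_fun_0_symmetric[OF prob_density_std_normal symmetric_density_std_normal]
  show "0 \<le> score_gap u" if "1 / 2 < u"
    using distr_fun_std_normal_increment[OF sign(1)[OF that]] u
    by (simp add: half distr_fun_J_vdW score_gap_def J_W_def)
  show "score_gap u \<le> 0" if "u \<le> 1 / 2"
    using distr_fun_std_normal_increment[OF sign(2)[OF that]] u
    by (simp add: half distr_fun_J_vdW score_gap_def J_W_def)
qed

lemma score_norm_J_vdW: "score_norm J_vdW = 1"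
proof -
  have "score_norm J_vdW = (\<integral>x. x\<^sup>2 \<partial>density lborel std_normal_density)"
    unfolding score_norm_def J_vdW_def
    by (rule set_integral_quantile[OF real_distribution_density[OF prob_density_std_normal]]) simp
  also have "\<dots> = 1"
    using std_normal_distribution_even_moments[of 1] by simp
  finally show ?thesis .
qed

lemma score_norm_J_W: "score_norm J_W = 1 / 12"
proof -
  have "score_norm J_W = (LBINT u:{0..1}. (J_W u)\<^sup>2)"
    unfolding score_norm_def
    by (rule set_integral_discrete_difference[where X="{0, 1}"]) auto
  also have "\<dots> = (1 - 1 / 2) ^ 3 / 3 - (0 - 1 / 2) ^ 3 / (3::real)"
    unfolding set_lebesgue_integral_def J_W_def
  proof (rule integral_FTC_atLeastAtMost)
    show "((\<lambda>u. (u - 1 / 2) ^ 3 / 3) has_vector_derivative (u - 1 / 2)\<^sup>2) (at u within {0..1})" for u :: real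
      unfolding has_real_derivative_iff_has_vector_derivative[symmetric]
      by (auto intro!: derivative_eq_intros)
  qed (auto intro!: continuous_intros)
  finally show ?thesis by (simp add: power3_eq_cube)
qed

subsection \<open>Comparison of the two scores\<close>

text \<open>Both bounds are instances of the inequality for monotone weights: \<open>J_W\<close> as
  weight gives the lower one, \<open>score_gap\<close> the upper one.\<close>

lemma score_K_bounds:
  assumes f: "f \<in> class_F" and nz: "score_K J_vdW f \<noteq> 0"
  shows "0 \<le> score_K J_W f" "score_K J_W f \<le> score_K J_vdW f / sqrt (2 * pi)"
proof -
  define L where "L u = location_score f (quantile_fun f u)" for u
  have L: "set_integrable lborel {0<..<1} L" "(LBINT u:{0<..<1}. L u) = 0"
    "\<And>s. s \<in> {0<..<1} \<Longrightarrow> 0 \<le> (LBINT u:{s..<1}. L u)"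
    using location_score_tails[OF f] by (auto simp: L_def[abs_def])
  \<comment> \<open>A function that is not integrable has integral 0 by convention, so a nonzero
    value certifies integrability.\<close>
  have vdW: "set_integrable lborel {0<..<1} (\<lambda>u. J_vdW u * L u)"
    using nz not_integrable_integral_eq
    unfolding score_K_def set_lebesgue_integral_def set_integrable_def L_def by blast
  have W: "set_integrable lborel {0<..<1} (\<lambda>u. J_W u * L u)"
    unfolding set_integrable_def
  proof (rule Bochner_Integration.integrable_bound)
    show Li: "integrable lborel (\<lambda>u. indicator {0<..<1} u *\<^sub>R L u)"
      using L(1) by (simp add: set_integrable_def)
    have "(\<lambda>u. J_W u * (indicator {0<..<1} u *\<^sub>R L u)) \<in> borel_measurable lborel"
      using borel_measurable_integrable[OF Li] unfolding J_W_def by measurable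
    then show "(\<lambda>u. indicator {0<..<1} u *\<^sub>R (J_W u * L u)) \<in> borel_measurable lborel"
      by (simp add: mult.left_commute)
    show "AE u in lborel. norm (indicator {0<..<1} u *\<^sub>R (J_W u * L u))
        \<le> norm (indicator {0<..<1} u *\<^sub>R L u)"
      by (intro AE_I2) (auto simp: indicator_def J_W_def abs_mult intro!: mult_left_le_one_le)
  qed
  have W_mono: "mono_on {0<..<1} J_W"
    by (auto simp: J_W_def mono_on_def)
  show "0 \<le> score_K J_W f"
    using set_integral_mono_weight_nonneg[OF L W_mono W] by (simp add: score_K_def L_def)
  have gap: "(\<lambda>u. score_gap u * L u) = (\<lambda>u. (J_vdW u * L u) / sqrt (2 * pi) - J_W u * L u)"
    by (auto simp: score_gap_def left_diff_distrib)
  have vdW': "set_integrable lborel {0<..<1} (\<lambda>u. (J_vdW u * L u) / sqrt (2 * pi))"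
    using vdW by (intro set_integrable_divide) auto
  have gap_int: "set_integrable lborel {0<..<1} (\<lambda>u. score_gap u * L u)"
    unfolding gap by (rule set_integral_diff(1)[OF vdW' W])
  have "0 \<le> (LBINT u:{0<..<1}. score_gap u * L u)"
    using set_integral_mono_weight_nonneg[OF L mono_on_score_gap gap_int] .
  also have "\<dots> = score_K J_vdW f / sqrt (2 * pi) - score_K J_W f"
    unfolding gap set_integral_diff(2)[OF vdW' W] set_integral_divide_zero
    by (simp add: score_K_def L_def)
  finally show "score_K J_W f \<le> score_K J_vdW f / sqrt (2 * pi)" by simp
qed

text \<open>Here the integrands themselves compare: the quantile function, \<open>J_W\<close> and
  \<open>score_gap\<close> all change sign at u = 1/2. The resulting pointwise sandwich also
  supplies the integrability of the middle term.\<close>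

lemma score_J_bounds:
  assumes f: "prob_density f" and sym: "symmetric_density f" and nz: "score_J J_vdW f \<noteq> 0"
  shows "0 \<le> score_J J_W f" "score_J J_W f \<le> score_J J_vdW f / sqrt (2 * pi)"
proof -
  define q where "q = quantile_fun f"
  have vdW: "set_integrable lborel {0<..<1} (\<lambda>u. J_vdW u * q u)"
    using nz not_integrable_integral_eq
    unfolding score_J_def set_lebesgue_integral_def set_integrable_def q_def by blast
  have W_nonneg: "0 \<le> J_W u * q u" and gap_nonneg: "0 \<le> score_gap u * q u" if "u \<in> {0<..<1}" for u
    using quantile_fun_sign[OF f sym that] score_gap_sign[OF that]
    by (cases "1 / 2 < u"; force simp: q_def J_W_def intro: mult_nonneg_nonneg mult_nonpos_nonpos)+
  have le: "J_W u * q u \<le> J_vdW u * q u / sqrt (2 * pi)" if "u \<in> {0<..<1}" for u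
    using gap_nonneg[OF that] by (simp add: score_gap_def left_diff_distrib)
  have vdW': "set_integrable lborel {0<..<1} (\<lambda>u. (J_vdW u * q u) / sqrt (2 * pi))"
    using vdW by (intro set_integrable_divide) auto
  have qm: "(\<lambda>u. indicator {0<..<1} u *\<^sub>R q u) \<in> borel_measurable borel"
    using measurable_quantile[OF real_distribution_density[OF f]]
    by (subst (asm) borel_measurable_restrict_space_iff) (auto simp: q_def)
  have W: "set_integrable lborel {0<..<1} (\<lambda>u. J_W u * q u)"
    using vdW' unfolding set_integrable_def
  proof (rule Bochner_Integration.integrable_bound)
    have "(\<lambda>u. J_W u * (indicator {0<..<1} u *\<^sub>R q u)) \<in> borel_measurable lborel"
      using qm unfolding J_W_def by measurable
    then show "(\<lambda>u. indicator {0<..<1} u *\<^sub>R (J_W u * q u)) \<in> borel_measurable lborel"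
      by (simp add: mult.left_commute)
    show "AE u in lborel. norm (indicator {0<..<1} u *\<^sub>R (J_W u * q u))
        \<le> norm (indicator {0<..<1} u *\<^sub>R (J_vdW u * q u / sqrt (2 * pi)))"
    proof (intro AE_I2)
      fix u
      show "norm (indicator {0<..<1} u *\<^sub>R (J_W u * q u))
        \<le> norm (indicator {0<..<1} u *\<^sub>R (J_vdW u * q u / sqrt (2 * pi)))"
        using W_nonneg[of u] le[of u] by (cases "u \<in> {0<..<1}") (simp_all del: abs_mult abs_divide)
    qed
  qed
  show "0 \<le> score_J J_W f"
    unfolding score_J_def set_lebesgue_integral_def
    using W_nonneg by (intro Bochner_Integration.integral_nonneg) (auto simp: indicator_def q_def)
  have "score_J J_W f \<le> (LBINT u:{0<..<1}. J_vdW u * q u / sqrt (2 * pi))"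
    unfolding score_J_def q_def[symmetric] by (rule set_integral_mono[OF W vdW' le])
  then show "score_J J_W f \<le> score_J J_vdW f / sqrt (2 * pi)"
    by (simp add: score_J_def q_def)
qed

text \<open>The bounds on a are conditional because the score integrals are compared only when the
  van der Waerden one is nonzero; for b = 0 the quotient is 0 by convention.\<close>

lemma sqr_ratio_le:
  fixes a b c :: real
  assumes "b \<noteq> 0 \<Longrightarrow> 0 \<le> a" "b \<noteq> 0 \<Longrightarrow> a \<le> b / c" "0 < c"
  shows "(a / b)\<^sup>2 \<le> 1 / c\<^sup>2"
proof (cases "b = 0")
  case False
  with assms have "0 \<le> a" "a * c \<le> b" by (auto simp: field_simps)
  with False assms(3) have "0 < b" by (smt (verit) mult_nonneg_nonneg)
  with \<open>0 \<le> a\<close> \<open>a * c \<le> b\<close> assms(3) have "(a / b)\<^sup>2 \<le> (1 / c)\<^sup>2"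
    by (intro power_mono) (auto simp: field_simps)
  then show ?thesis by (simp add: power_divide)
qed (use assms(3) in simp)

theorem mainTheorem4:
  fixes f :: "real \<Rightarrow> real"
  assumes "f \<in> class_F2 \<inter> class_FJ J_vdW"
    and "symmetric_density f"
  shows "ARE_SWW_vdW f = ARE_Kendall_vdW f \<and> ARE_Kendall_vdW f \<le> (6 / pi)\<^sup>2"
proof
  \<comment> \<open>With equal scores in both slots the two norm ratios of \<open>ARE_serial\<close>
    coincide and form the square in the Kendall formula.\<close>
  show "ARE_SWW_vdW f = ARE_Kendall_vdW f"
    by (simp add: ARE_SWW_vdW_def ARE_Kendall_vdW_def ARE_serial_def power2_eq_square mult_ac)
  have F: "f \<in> class_F" and f: "prob_density f"
    using assms(1) by (auto simp: class_F2_def class_F_def)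
  have K: "(score_K J_W f / score_K J_vdW f)\<^sup>2 \<le> 1 / (sqrt (2 * pi))\<^sup>2"
    by (rule sqr_ratio_le) (use score_K_bounds[OF F] in auto)
  have J: "(score_J J_W f / score_J J_vdW f)\<^sup>2 \<le> 1 / (sqrt (2 * pi))\<^sup>2"
    by (rule sqr_ratio_le) (use score_J_bounds[OF f assms(2)] in auto)
  have "ARE_Kendall_vdW f =
      144 * ((score_K J_W f / score_K J_vdW f)\<^sup>2 * (score_J J_W f / score_J J_vdW f)\<^sup>2)"
    by (simp add: ARE_Kendall_vdW_def score_norm_J_vdW score_norm_J_W)
  also have "\<dots> \<le> 144 * (1 / (sqrt (2 * pi))\<^sup>2 * (1 / (sqrt (2 * pi))\<^sup>2))"
    by (intro mult_left_mono mult_mono K J) auto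
  also have "\<dots> = (6 / pi)\<^sup>2"
    by (simp add: power2_eq_square)
  finally show "ARE_Kendall_vdW f \<le> (6 / pi)\<^sup>2" .
qed

end
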